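(* Let $A$, $b$, $c$ be such that the integer program $\max\{c^\top x : Ax\le b,\ x\in\mathbb{Z}^n\}$ has $\Gamma\le \mathcal{S}_n$ as symmetry group, where $\Gamma$ is given by a set $\Pi$ of generators of size polynomial in $n$, and assume that the program can be solved in time $T$. Let $L$ be a sequence of leaders derived from $\Gamma$ by the SST algorithm and let $S=S(L)$ be the corresponding set of SST cuts. Then the program $\max\{c^\top x : Ax\le b,\ x\in \mathcal{K}(S)\cap\mathbb{Z}^n\}$ can be solved in time $T+\mathrm{poly}(n)$.
   Context: $\mathcal{S}_n$ is the symmetric group on $[n]=\{1,\dots,n\}$. A permutation $\gamma\in\mathcal{S}_n$ acts on vectors by $\gamma(x)=(x_{\gamma^{-1}(1)},\dots,x_{\gamma^{-1}(n)})$. A symmetry of the integer program is a permutation $\gamma$ mapping every feasible solution $x$ to a feasible solution $\gamma(x)$ with the same objective value; a symmetry group is a group of symmetries. For a group $\Gamma\le\mathcal{S}_n$: the orbit of $i\in[n]$ is $\mathrm{orb}(i,\Gamma)=\{\gamma(i):\gamma\in\Gamma\}$, and the pointwise stabilizer of $I\subseteq[n]$ is $\mathrm{stab}(\Gamma,I)=\{\gamma\in\Gamma:\gamma(i)=i \text{ for all } i\in I\}$. SST algorithm: initialize $\Gamma'\gets\Gamma$ and the empty sequence $L$. Repeat until $L$ contains all of $[n]$: (1) select (arbitrarily) $\ell\in[n]\setminus L$ and set $O_\ell\gets\mathrm{orb}(\ell,\Gamma')$; (2) append $\ell$ to $L$ and set $\Gamma'\gets\mathrm{stab}(\Gamma',L)$.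 The elements $\ell$ of the resulting sequence $L$ are called leaders and the elements of $O_\ell\setminus\{\ell\}$ followers of $\ell$. The set of SST cuts is $S(L)=\{(\ell,f):\ell\in L,\ f\in O_\ell\setminus\{\ell\}\}$, where $(\ell,f)$ represents the inequality $-x_\ell+x_f\le 0$. For $S\subseteq S(L)$, $\mathcal{K}(S)=\{x\in\mathbb{R}^n: -x_\ell+x_f\le 0 \text{ for all }(\ell,f)\in S\}$. *)

theory Defs
  imports
    "HOL-Algebra.Sym_Groups"
    "HOL-Algebra.Generated_Groups"
    "HOL-Computational_Algebra.Polynomial"
    "HOL-Library.FuncSet"
begin

section \<open>Integer programs and symmetries\<close>

text \<open>
  A vector in $R^n$ is a function on \<open>{1..n}\<close>, extended by \<open>undefined\<close> (as usual for
  \<^term>\<open>PiE\<close>), and only the entries \<open>A i j\<close>, \<open>b i\<close>, \<open>c j\<close> with \<open>i \<in> {1..m}\<close> and \<open>j \<in> {1..n}\<close>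
  matter. The data are rational because they have to be given to an algorithm.
\<close>

definition real_vectors :: "nat \<Rightarrow> (nat \<Rightarrow> real) set" where
  "real_vectors n = {1..n} \<rightarrow>\<^sub>E UNIV"

definition int_vectors :: "nat \<Rightarrow> (nat \<Rightarrow> real) set" where
  "int_vectors n = {1..n} \<rightarrow>\<^sub>E \<int>"

definition feasible :: "nat \<Rightarrow> nat \<Rightarrow> (nat \<Rightarrow> nat \<Rightarrow> rat) \<Rightarrow> (nat \<Rightarrow> rat) \<Rightarrow> (nat \<Rightarrow> real) set" where
  "feasible n m A b =
     {x \<in> int_vectors n. \<forall>i\<in>{1..m}. (\<Sum>j=1..n. of_rat (A i j) * x j) \<le> of_rat (b i)}"

definition objective :: "nat \<Rightarrow> (nat \<Rightarrow> rat) \<Rightarrow> (nat \<Rightarrow> real) \<Rightarrow> real" where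
  "objective n c x = (\<Sum>j=1..n. of_rat (c j) * x j)"

text \<open>Component \<open>i\<close> of \<open>\<gamma>(x)\<close> is component \<open>\<gamma>\<^sup>-\<^sup>1(i)\<close> of \<open>x\<close> (plain \<open>inv\<close> is the group
  inverse of HOL-Algebra here). The result is again in \<^term>\<open>real_vectors n\<close>, since a permutation of \<open>{1..n}\<close> fixes every other number.\<close>

definition perm_act :: "(nat \<Rightarrow> nat) \<Rightarrow> (nat \<Rightarrow> real) \<Rightarrow> (nat \<Rightarrow> real)" where
  "perm_act \<gamma> x = (\<lambda>i. x (inv_into UNIV \<gamma> i))"

definition is_symmetry ::
  "nat \<Rightarrow> nat \<Rightarrow> (nat \<Rightarrow> nat \<Rightarrow> rat) \<Rightarrow> (nat \<Rightarrow> rat) \<Rightarrow> (nat \<Rightarrow> rat) \<Rightarrow> (nat \<Rightarrow> nat) \<Rightarrow> bool" where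
  "is_symmetry n m A b c \<gamma> \<longleftrightarrow> \<gamma> permutes {1..n} \<and>
     (\<forall>x\<in>feasible n m A b. perm_act \<gamma> x \<in> feasible n m A b \<and>
                           objective n c (perm_act \<gamma> x) = objective n c x)"

definition is_symmetry_group ::
  "nat \<Rightarrow> nat \<Rightarrow> (nat \<Rightarrow> nat \<Rightarrow> rat) \<Rightarrow> (nat \<Rightarrow> rat) \<Rightarrow> (nat \<Rightarrow> rat) \<Rightarrow> (nat \<Rightarrow> nat) set \<Rightarrow> bool" where
  "is_symmetry_group n m A b c \<Gamma> \<longleftrightarrow>
     subgroup \<Gamma> (sym_group n) \<and> (\<forall>\<gamma>\<in>\<Gamma>. is_symmetry n m A b c \<gamma>)"


section \<open>SST cuts\<close>

definition orb :: "nat \<Rightarrow> (nat \<Rightarrow> nat) set \<Rightarrow> nat set" where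
  "orb i \<Gamma> = {\<gamma> i |\<gamma>. \<gamma> \<in> \<Gamma>}"

definition stab :: "(nat \<Rightarrow> nat) set \<Rightarrow> nat set \<Rightarrow> (nat \<Rightarrow> nat) set" where
  "stab \<Gamma> I = {\<gamma> \<in> \<Gamma>. \<forall>i\<in>I. \<gamma> i = i}"

text \<open>\<open>sst_state n \<Gamma> \<Gamma>' L Orb\<close>: after finitely many iterations of the SST algorithm on \<open>\<Gamma>\<close>,
  for some choice of leaders, the current group is \<open>\<Gamma>'\<close>, the current sequence is \<open>L\<close>, and
  \<open>Orb l\<close> is the recorded orbit of each leader \<open>l\<close> in \<open>L\<close>.\<close>

inductive sst_state ::
  "nat \<Rightarrow> (nat \<Rightarrow> nat) set \<Rightarrow> (nat \<Rightarrow> nat) set \<Rightarrow> nat list \<Rightarrow> (nat \<Rightarrow> nat set) \<Rightarrow> bool"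
  for n \<Gamma> where
  init: "sst_state n \<Gamma> \<Gamma> [] (\<lambda>_. {})"
| step: "sst_state n \<Gamma> \<Gamma>' L Orb \<Longrightarrow> l \<in> {1..n} - set L \<Longrightarrow>
           sst_state n \<Gamma> (stab \<Gamma>' (set (L @ [l]))) (L @ [l]) (Orb(l := orb l \<Gamma>'))"

definition sst_output :: "nat \<Rightarrow> (nat \<Rightarrow> nat) set \<Rightarrow> nat list \<Rightarrow> (nat \<Rightarrow> nat set) \<Rightarrow> bool" where
  "sst_output n \<Gamma> L Orb \<longleftrightarrow> (\<exists>\<Gamma>'. sst_state n \<Gamma> \<Gamma>' L Orb) \<and> {1..n} \<subseteq> set L"

definition sst_cuts :: "nat list \<Rightarrow> (nat \<Rightarrow> nat set) \<Rightarrow> (nat \<times> nat) set" where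
  "sst_cuts L Orb = {(l, f). l \<in> set L \<and> f \<in> Orb l - {l}}"

definition cut_cone :: "nat \<Rightarrow> (nat \<times> nat) set \<Rightarrow> (nat \<Rightarrow> real) set" where
  "cut_cone n S = {x \<in> real_vectors n. \<forall>(l, f)\<in>S. - x l + x f \<le> 0}"


section \<open>The machine model\<close>

text \<open>
  A random access machine with integer cells, unit-cost addition, subtraction and comparison, and
  indirect addressing. Multiplication is omitted on purpose: with it, unit cost would no longer be
  polynomially related to Turing machine time. Unit cost (rather than logarithmic cost) is what
  makes a bound of the form \<open>T + poly(n)\<close> meaningful: the additional work handles
  the entries of a solution, whose bit length is not bounded in terms of \<open>n\<close>.

  The memory is divided into named arrays, indexed by the integers; a scalar variable is the cell
  with index 0 of its array. A program can refer only to the finitely many arrays that occur in it.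
\<close>

type_synonym store = "string \<Rightarrow> int \<Rightarrow> int"

datatype aexp =
    Const int
  | Read string aexp
  | Plus aexp aexp
  | Minus aexp aexp

datatype bexp =
    Less aexp aexp
  | Neg bexp
  | Conj bexp bexp

datatype com =
    Skip
  | Assign string aexp aexp
  | Seq com com
  | If bexp com com
  | While bexp com

fun aval :: "aexp \<Rightarrow> store \<Rightarrow> int" where
  "aval (Const k) s = k"
| "aval (Read v e) s = s v (aval e s)"
| "aval (Plus e1 e2) s = aval e1 s + aval e2 s"
| "aval (Minus e1 e2) s = aval e1 s - aval e2 s"

fun bval :: "bexp \<Rightarrow> store \<Rightarrow> bool" where
  "bval (Less e1 e2) s \<longleftrightarrow> aval e1 s < aval e2 s"
| "bval (Neg g) s \<longleftrightarrow> \<not> bval g s"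
| "bval (Conj g1 g2) s \<longleftrightarrow> bval g1 s \<and> bval g2 s"

fun acost :: "aexp \<Rightarrow> nat" where
  "acost (Const k) = 1"
| "acost (Read v e) = acost e + 1"
| "acost (Plus e1 e2) = acost e1 + acost e2 + 1"
| "acost (Minus e1 e2) = acost e1 + acost e2 + 1"

fun bcost :: "bexp \<Rightarrow> nat" where
  "bcost (Less e1 e2) = acost e1 + acost e2 + 1"
| "bcost (Neg g) = bcost g + 1"
| "bcost (Conj g1 g2) = bcost g1 + bcost g2 + 1"

text \<open>\<open>exec C s t s'\<close>: started in \<open>s\<close>, the program \<open>C\<close> terminates in \<open>s'\<close> after \<open>t\<close> steps.
  The command \<open>Assign v i e\<close> stores the value of \<open>e\<close> in cell \<open>i\<close> of the array \<open>v\<close>.\<close>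

inductive exec :: "com \<Rightarrow> store \<Rightarrow> nat \<Rightarrow> store \<Rightarrow> bool" where
  Skip: "exec Skip s 1 s"
| Assign: "exec (Assign v i e) s (acost i + acost e + 1)
             (s(v := (s v)(aval i s := aval e s)))"
| Seq: "exec C1 s t1 s1 \<Longrightarrow> exec C2 s1 t2 s2 \<Longrightarrow> exec (Seq C1 C2) s (t1 + t2) s2"
| IfTrue: "bval g s \<Longrightarrow> exec C1 s t s1 \<Longrightarrow> exec (If g C1 C2) s (bcost g + 1 + t) s1"
| IfFalse: "\<not> bval g s \<Longrightarrow> exec C2 s t s1 \<Longrightarrow> exec (If g C1 C2) s (bcost g + 1 + t) s1"
| WhileFalse: "\<not> bval g s \<Longrightarrow> exec (While g C) s (bcost g + 1) s"
| WhileTrue: "bval g s \<Longrightarrow> exec C s t1 s1 \<Longrightarrow> exec (While g C) s1 t2 s2 \<Longrightarrow>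
                exec (While g C) s (bcost g + 1 + t1 + t2) s2"


section \<open>Input, output and running time\<close>

definition scalar :: "int \<Rightarrow> int \<Rightarrow> int" where
  "scalar k = (\<lambda>i. if i = 0 then k else 0)"

text \<open>List entries are stored in the cells \<open>1, 2, \<dots>\<close>\<close>

definition array :: "int list \<Rightarrow> int \<Rightarrow> int" where
  "array xs = (\<lambda>i. if 1 \<le> i \<and> i \<le> int (length xs) then xs ! nat (i - 1) else 0)"

definition numer :: "rat \<Rightarrow> int" where
  "numer r = fst (quotient_of r)"

definition denom :: "rat \<Rightarrow> int" where
  "denom r = snd (quotient_of r)"

text \<open>Matrices are stored row by row: \<open>A i j\<close> is in cell \<open>(i - 1) * n + j\<close>.\<close>

definition ip_input ::
  "nat \<Rightarrow> nat \<Rightarrow> (nat \<Rightarrow> nat \<Rightarrow> rat) \<Rightarrow> (nat \<Rightarrow> rat) \<Rightarrow> (nat \<Rightarrow> rat) \<Rightarrow> store" where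
  "ip_input n m A b c = (\<lambda>_ _. 0)
     (''n'' := scalar (int n),
      ''m'' := scalar (int m),
      ''A_num'' := array [numer (A i j). i \<leftarrow> [1..<Suc m], j \<leftarrow> [1..<Suc n]],
      ''A_den'' := array [denom (A i j). i \<leftarrow> [1..<Suc m], j \<leftarrow> [1..<Suc n]],
      ''b_num'' := array [numer (b i). i \<leftarrow> [1..<Suc m]],
      ''b_den'' := array [denom (b i). i \<leftarrow> [1..<Suc m]],
      ''c_num'' := array [numer (c j). j \<leftarrow> [1..<Suc n]],
      ''c_den'' := array [denom (c j). j \<leftarrow> [1..<Suc n]])"

text \<open>The program with the SST cuts is given by the integer program, the generators of the symmetry
  group (each listed as \<open>\<pi> 1, \<dots>, \<pi> n\<close>) and the sequence of leaders. These
  determine the cuts, which are not themselves part of the input.\<close>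

definition sst_ip_input ::
  "nat \<Rightarrow> nat \<Rightarrow> (nat \<Rightarrow> nat \<Rightarrow> rat) \<Rightarrow> (nat \<Rightarrow> rat) \<Rightarrow> (nat \<Rightarrow> rat) \<Rightarrow>
     (nat \<Rightarrow> nat) list \<Rightarrow> nat list \<Rightarrow> store" where
  "sst_ip_input n m A b c gens L = (ip_input n m A b c)
     (''gens_count'' := scalar (int (length gens)),
      ''gens'' := array [int (\<pi> i). \<pi> \<leftarrow> gens, i \<leftarrow> [1..<Suc n]],
      ''leaders'' := array (map int L))"

definition out_vector :: "nat \<Rightarrow> store \<Rightarrow> nat \<Rightarrow> real" where
  "out_vector n s = (\<lambda>i\<in>{1..n}. of_int (s ''x'' (int i)))"

text \<open>A solution of \<open>max {c\<^sup>T x : x \<in> X}\<close> is an optimal point (status 1), or the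
  information that \<open>X\<close> is empty (status 0) or that the objective is unbounded on \<open>X\<close> (status 2).\<close>

definition correct_output :: "nat \<Rightarrow> (nat \<Rightarrow> rat) \<Rightarrow> (nat \<Rightarrow> real) set \<Rightarrow> store \<Rightarrow> bool" where
  "correct_output n c X s \<longleftrightarrow>
     (s ''status'' 0 = 0 \<and> X = {}) \<or>
     (s ''status'' 0 = 1 \<and> out_vector n s \<in> X \<and>
        (\<forall>y\<in>X. objective n c y \<le> objective n c (out_vector n s))) \<or>
     (s ''status'' 0 = 2 \<and> (\<forall>B. \<exists>y\<in>X. objective n c y > B))"

definition solves_in_time ::
  "com \<Rightarrow> store \<Rightarrow> nat \<Rightarrow> (nat \<Rightarrow> rat) \<Rightarrow> (nat \<Rightarrow> real) set \<Rightarrow> nat \<Rightarrow> bool" where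
  "solves_in_time P s n c X T \<longleftrightarrow> (\<exists>t s'. exec P s t s' \<and> t \<le> T \<and> correct_output n c X s')"

end

theory Submission
  imports Defs
begin

text \<open>
  Call the leaders \<open>L ! 0, \<dots>, L ! (n - 1)\<close> and let \<open>\<Gamma>\<^sub>k\<close> be the subgroup of \<open>\<Gamma>\<close> that fixes the first
  \<open>k\<close> of them. The cuts say that for every \<open>k\<close> the value of \<open>x\<close> at \<open>L ! k\<close> is the largest one on
  the orbit of \<open>L ! k\<close> under \<open>\<Gamma>\<^sub>k\<close>. Any feasible \<open>x\<close> can be moved by \<open>\<Gamma>\<close> into the cone: for
  \<open>k = 0, 1, \<dots>\<close> pick a position \<open>j\<close> of the orbit with the largest value and apply some \<open>u \<in> \<Gamma>\<^sub>k\<close> with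
  \<open>u j = L ! k\<close>. Since \<open>u\<close> fixes the earlier leaders and permutes their orbits, the cuts of the
  earlier levels survive (\<open>cuts_hold_step\<close>). The result is feasible and has the same objective value,
  so emptiness, unboundedness and the optimal value do not change when the cuts are added, and it
  suffices to run the given solver and then to move its optimal point into the cone.

  The permutations \<open>u\<close> are found by the sifting procedure of Furst, Hopcroft and Luks, an early form
  of the Schreier-Sims algorithm. A table has in entry \<open>(k, j)\<close> either nothing or some \<open>u \<in> \<Gamma>\<^sub>k\<close>
  with \<open>u j = L ! k\<close>. To sift \<open>g\<close>, go through the levels \<open>k = 0, 1, \<dots>\<close>; if \<open>g\<close> moves \<open>L ! k\<close> to
  \<open>j \<noteq> L ! k\<close>, replace \<open>g\<close> by \<open>u \<circ> g\<close>, where \<open>u\<close> is entry \<open>(k, j)\<close>, after filling this entry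
  with the inverse of \<open>g\<close> if it was empty. The pool of permutations consists of the generators, the
  identity and the table entries; all products of two inverses of pool members are sifted, which ends
  because there are at most \<open>n\<^sup>2\<close> entries. Then every element of \<open>\<Gamma>\<close> sifts to the identity
  through the final table (\<open>sifts_all\<close>), so the filled entries of row \<open>k\<close> are the orbit of
  \<open>L ! k\<close> under \<open>\<Gamma>\<^sub>k\<close>, except for \<open>L ! k\<close> itself (\<open>sifts_orbit\<close>).

  On the machine, the arrays of the given solver are renamed injectively so that it cannot
  touch the generators, the leaders and the working memory. Renaming changes neither results nor
  running times (\<open>exec_rename\<close>), so the solver still takes at most \<open>T\<close> steps, and the number of
  the other steps is bounded by a polynomial in \<open>n\<close> and the number of generators.
\<close>

section \<open>Sifting through a stabilizer chain\<close>

text \<open>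
  The inverse of a permutation of type \<^typ>\<open>nat \<Rightarrow> nat\<close>; plain \<open>inv\<close> denotes the inverse in an
  abstract group.
\<close>

abbreviation pinv :: "(nat \<Rightarrow> nat) \<Rightarrow> nat \<Rightarrow> nat" where
  "pinv \<equiv> inv_into UNIV"

text \<open>
  \<open>sifts L W k g\<close>: from level \<open>k\<close> on, \<open>g\<close> is reduced to the identity by the table \<open>W\<close>. A level
  is passed either because \<open>g\<close> fixes its leader already, or by multiplying with the table entry
  that brings the image of the leader back. No entry is needed for the leader itself.
\<close>

inductive sifts :: "nat list \<Rightarrow> (nat \<Rightarrow> nat \<Rightarrow> (nat \<Rightarrow> nat) option) \<Rightarrow> nat \<Rightarrow> (nat \<Rightarrow> nat) \<Rightarrow> bool"
  for L W where
  sifts_id: "sifts L W (length L) id"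
| sifts_skip: "g (L ! k) = L ! k \<Longrightarrow> sifts L W (Suc k) g \<Longrightarrow> sifts L W k g"
| sifts_strip: "W k (g (L ! k)) = Some u \<Longrightarrow> sifts L W (Suc k) (u \<circ> g) \<Longrightarrow> sifts L W k g"

lemma sifts_le: "sifts L W k g \<Longrightarrow> k \<le> length L"
  by (induction rule: sifts.induct) auto

lemma sifts_id_below: "k \<le> length L \<Longrightarrow> sifts L W k id"
proof (induction k rule: inc_induct)
  case base
  show ?case by (rule sifts_id)
next
  case (step k)
  show ?case by (rule sifts_skip[OF _ step.IH]) simp
qed

lemma sifts_mono:
  assumes "sifts L W k g" "\<And>k j u. W k j = Some u \<Longrightarrow> W' k j = Some u"
  shows "sifts L W' k g"
  using assms(1) by induction (blast intro: sifts.intros assms(2))+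

text \<open>
  A permutation group together with a sequence of leaders that contains every point once.
\<close>

locale sst_group =
  fixes n :: nat and \<Gamma> :: "(nat \<Rightarrow> nat) set" and L :: "nat list"
  assumes subgroup: "subgroup \<Gamma> (sym_group n)"
    and distinct_L: "distinct L" and set_L: "set L = {1..n}"
begin

lemma length_L: "length L = n"
  using distinct_card[OF distinct_L] set_L by simp

lemma L_in: "k < n \<Longrightarrow> L ! k \<in> {1..n}"
  using set_L length_L nth_mem by metis

lemma perm: "g \<in> \<Gamma> \<Longrightarrow> g permutes {1..n}"
  using subgroup.subset[OF subgroup] by (auto simp: sym_group_def)

lemma id_in: "id \<in> \<Gamma>"
  using subgroup.one_closed[OF subgroup] by (simp add: sym_group_def)

lemma comp_in: "g \<in> \<Gamma> \<Longrightarrow> h \<in> \<Gamma> \<Longrightarrow> g \<circ> h \<in> \<Gamma>"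
  using subgroup.m_closed[OF subgroup] by (simp add: sym_group_def)

lemma pinv_in: "g \<in> \<Gamma> \<Longrightarrow> pinv g \<in> \<Gamma>"
  using subgroup.m_inv_closed[OF subgroup, of g] subgroup.subset[OF subgroup]
  by (auto simp: sym_group_inv_equality subset_iff)

lemma fix_all: assumes "g \<in> \<Gamma>" "\<And>i. i < n \<Longrightarrow> g (L ! i) = L ! i" shows "g = id"
proof
  fix y show "g y = id y"
  proof (cases "y \<in> {1..n}")
    case True
    then obtain i where "i < n" "y = L ! i" using set_L length_L by (metis in_set_conv_nth)
    then show ?thesis using assms(2) by simp
  next
    case False
    then show ?thesis using permutes_not_in[OF perm[OF assms(1)]] by simp
  qed
qed

text \<open>
  Entry \<open>(k, j)\<close> of a table, if present, is a member of the group that fixes the first \<open>k\<close> leaders and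
  maps \<open>j\<close> to leader \<open>k\<close>. The entry for the leader itself is absent and stands for the identity.
\<close>

definition valid_table :: "(nat \<Rightarrow> nat \<Rightarrow> (nat \<Rightarrow> nat) option) \<Rightarrow> bool" where
  "valid_table W \<longleftrightarrow> (\<forall>k j u. W k j = Some u \<longrightarrow>
     u \<in> \<Gamma> \<and> k < n \<and> j \<noteq> L ! k \<and> u j = L ! k \<and> (\<forall>i<k. u (L ! i) = L ! i))"

context
  fixes W :: "nat \<Rightarrow> nat \<Rightarrow> (nat \<Rightarrow> nat) option"
  assumes valid: "valid_table W"
begin

lemma sifts_fixes: "sifts L W k g \<Longrightarrow> i < k \<Longrightarrow> g (L ! i) = L ! i"
proof (induction rule: sifts.induct)
  case (sifts_strip k g u)
  have "u \<in> \<Gamma>" "u (L ! i) = L ! i"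
    using valid sifts_strip by (auto simp: valid_table_def)
  moreover have "u (g (L ! i)) = L ! i" using sifts_strip by simp
  ultimately show ?case using permutes_inj[OF perm] by (metis injD)
qed auto

lemma sifts_raise:
  assumes "sifts L W 0 g" "k \<le> n" "\<And>i. i < k \<Longrightarrow> g (L ! i) = L ! i"
  shows "sifts L W k g"
  using assms(2,3)
proof (induction k)
  case (Suc k)
  then have "sifts L W k g" by simp
  then show ?case
  proof cases
    case sifts_id
    then show ?thesis using Suc.prems length_L by simp
  next
    case (sifts_strip u)
    \<comment> \<open>Row \<open>k\<close> has no entry for \<open>L ! k\<close>, which is fixed by \<open>g\<close>.\<close>
    then show ?thesis using Suc.prems valid by (auto simp: valid_table_def)
  qed
qed (use assms(1) in simp)

text \<open>
  The inverses of the entries of row \<open>k\<close>, with the identity: at most one permutation for each image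
  of leader \<open>k\<close>. The permutations that sift from level \<open>k\<close> on are the products \<open>t\<^sub>k \<circ> \<dots> \<circ> t\<^sub>n\<^sub>-\<^sub>1\<close> of
  members \<open>t\<^sub>i\<close> of \<open>transversal i\<close>; \<open>sifts_split\<close> and \<open>sifts_join\<close> express this one level at a time.
\<close>

definition transversal :: "nat \<Rightarrow> (nat \<Rightarrow> nat) set" where
  "transversal k = insert id {pinv u |u j. W k j = Some u}"

lemma sifts_split:
  assumes "sifts L W k g" "k < n"
  obtains t h where "t \<in> transversal k" "sifts L W (Suc k) h" "g = t \<circ> h"
  using assms(1)
proof cases
  case sifts_id
  then show ?thesis using assms(2) length_L by simp
next
  case sifts_skip
  then show ?thesis using that[of id g] by (simp add: transversal_def)
next
  case (sifts_strip u)
  then have "u \<in> \<Gamma>" using valid by (auto simp: valid_table_def)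
  then have "g = pinv u \<circ> (u \<circ> g)"
    using permutes_inv_o(2)[OF perm] by (metis comp_assoc id_comp)
  then show ?thesis using that[of "pinv u" "u \<circ> g"] sifts_strip by (auto simp: transversal_def)
qed

lemma sifts_join:
  assumes "t \<in> transversal k" "sifts L W (Suc k) h"
  shows "sifts L W k (t \<circ> h)"
proof -
  have h: "h (L ! k) = L ! k" using sifts_fixes[OF assms(2)] by simp
  consider "t = id" | u j where "W k j = Some u" "t = pinv u"
    using assms(1) by (auto simp: transversal_def)
  then show ?thesis
  proof cases
    case 1
    then show ?thesis using h assms(2) by (auto intro: sifts_skip)
  next
    case 2
    then have u: "u \<in> \<Gamma>" "u j = L ! k" using valid by (auto simp: valid_table_def)
    then have "t (L ! k) = j" using 2 permutes_inverses(2)[OF perm] by metis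
    then have "(t \<circ> h) (L ! k) = j" using h by simp
    moreover have "u \<circ> (t \<circ> h) = h"
      using 2 permutes_inv_o(1)[OF perm[OF u(1)]] by (metis comp_assoc id_comp)
    ultimately show ?thesis using 2(1) assms(2) sifts_strip by metis
  qed
qed

lemma transversal_fixes:
  assumes "t \<in> transversal k" "i < k" shows "t (L ! i) = L ! i"
proof -
  consider "t = id" | u j where "W k j = Some u" "t = pinv u"
    using assms(1) by (auto simp: transversal_def)
  then show ?thesis
  proof cases
    case 2
    then have "u \<in> \<Gamma>" "u (L ! i) = L ! i" using valid assms(2) by (auto simp: valid_table_def)
    then show ?thesis using 2 permutes_inverses(2)[OF perm] by metis
  qed simp
qed

text \<open>
  Write \<open>T\<close> for row \<open>k\<close> of the transversals and \<open>H\<close> for the permutations that sift from level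
  \<open>Suc k\<close> on. By downward induction \<open>H\<close> is closed under products, and sifting the products of two
  transversal members gives \<open>H \<circ> T \<subseteq> T \<circ> H\<close> (the fact \<open>swap\<close>) and \<open>T \<circ> T \<subseteq> T \<circ> H\<close>. Hence
  \<open>T \<circ> H \<circ> T \<circ> H \<subseteq> T \<circ> H\<close>, so the permutations that sift from level \<open>k\<close> on are closed under products.
\<close>

lemma sifts_comp:
  assumes pairs: "\<And>i j t t'. t \<in> transversal i \<Longrightarrow> t' \<in> transversal j \<Longrightarrow> sifts L W 0 (t \<circ> t')"
    and "k \<le> n" "sifts L W k g" "sifts L W k h"
  shows "sifts L W k (g \<circ> h)"
  using assms(2-4)
proof (induction k arbitrary: g h rule: inc_induct)
  case base
  have "g' = id" if "sifts L W n g'" for g'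
    using that by cases (use length_L in \<open>auto dest: sifts_le\<close>)
  from this[OF base(1)] this[OF base(2)] have "g \<circ> h = id" by simp
  then show ?case using sifts_id[of L W] length_L by metis
next
  case (step k)
  have pairs_k: "sifts L W k (t \<circ> t')"
    if "t \<in> transversal i" "k \<le> i" "t' \<in> transversal k" for i t t'
  proof (rule sifts_raise[OF pairs[OF that(1,3)]])
    show "k \<le> n" using step.hyps by simp
    fix i' assume "i' < k"
    then show "(t \<circ> t') (L ! i') = L ! i'"
      using transversal_fixes[OF that(1), of i'] transversal_fixes[OF that(3), of i'] that(2) by simp
  qed
  have swap: "sifts L W k (h \<circ> t)" if "sifts L W i h" "Suc k \<le> i" "t \<in> transversal k" for i h t
    using that
  proof (induction rule: sifts.induct)
    case sifts_id
    show ?case using sifts_join[OF \<open>t \<in> transversal k\<close> sifts_id_below] step.hyps length_L by simp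
  next
    case (sifts_strip i h u)
    have "sifts L W k ((u \<circ> h) \<circ> t)"
      by (rule sifts_strip.IH) (use sifts_strip.prems in simp_all)
    then obtain t' h' where t': "t' \<in> transversal k" "sifts L W (Suc k) h'" "(u \<circ> h) \<circ> t = t' \<circ> h'"
      using sifts_split step.hyps by metis
    have "pinv u \<in> transversal i" using sifts_strip by (auto simp: transversal_def)
    then have "sifts L W k (pinv u \<circ> t')" using pairs_k t'(1) sifts_strip.prems by simp
    then obtain t'' h'' where t'': "t'' \<in> transversal k" "sifts L W (Suc k) h''" "pinv u \<circ> t' = t'' \<circ> h''"
      using sifts_split step.hyps by metis
    have "u \<in> \<Gamma>" using sifts_strip valid by (auto simp: valid_table_def)
    then have "h = pinv u \<circ> (u \<circ> h)"
      using permutes_inv_o(2)[OF perm] by (metis comp_assoc id_comp)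
    then have "h \<circ> t = t'' \<circ> (h'' \<circ> h')" using t'(3) t''(3) by (metis comp_assoc)
    then show ?case using sifts_join[OF t''(1) step.IH[OF t''(2) t'(2)]] by metis
  qed simp
  obtain t h1 where t: "t \<in> transversal k" "sifts L W (Suc k) h1" "g = t \<circ> h1"
    using sifts_split step by metis
  obtain t' h2 where t': "t' \<in> transversal k" "sifts L W (Suc k) h2" "h = t' \<circ> h2"
    using sifts_split step by metis
  obtain t'' h3 where t'': "t'' \<in> transversal k" "sifts L W (Suc k) h3" "h1 \<circ> t' = t'' \<circ> h3"
    using sifts_split[OF swap[OF t(2) _ t'(1)]] step by auto
  obtain s h4 where s: "s \<in> transversal k" "sifts L W (Suc k) h4" "t \<circ> t'' = s \<circ> h4"
    using sifts_split[OF pairs_k[OF t(1) _ t''(1)]] step by auto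
  have "g \<circ> h = s \<circ> (h4 \<circ> (h3 \<circ> h2))"
    using t(3) t'(3) t''(3) s(3) by (metis comp_assoc)
  then show ?case using sifts_join[OF s(1) step.IH[OF s(2) step.IH[OF t''(2) t'(2)]]] by metis
qed

text \<open>
  The permutations that sift are closed under products, hence, as they have finite order, under
  inverses. The pair of a generator and the identity, which is in the pool, shows that the inverse of
  the generator sifts, so the generator does.
\<close>

lemma sifts_all:
  assumes gen: "\<Gamma> = generate (sym_group n) G"
    and pool: "X \<subseteq> \<Gamma>" "id \<in> X" "G \<subseteq> X" "\<And>k j u. W k j = Some u \<Longrightarrow> u \<in> X"
    and pairs: "\<And>u v. u \<in> X \<Longrightarrow> v \<in> X \<Longrightarrow> sifts L W 0 (pinv (v \<circ> u))"
    and g: "g \<in> \<Gamma>"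
  shows "sifts L W 0 g"
proof -
  have trans: "\<exists>u\<in>X. t = pinv u" if "t \<in> transversal k" for t k
  proof -
    consider "t = pinv id" | u j where "W k j = Some u" "t = pinv u"
      using \<open>t \<in> transversal k\<close> by (auto simp: transversal_def)
    then show ?thesis using pool(2,4) by cases blast+
  qed
  have comp: "sifts L W 0 (g \<circ> h)" if "sifts L W 0 g" "sifts L W 0 h" for g h
  proof (rule sifts_comp[OF _ _ that])
    fix i j t t' assume "t \<in> transversal i" "t' \<in> transversal j"
    then obtain u v where uv: "u \<in> X" "v \<in> X" "t = pinv u" "t' = pinv v" using trans by metis
    then have "u \<in> \<Gamma>" "v \<in> \<Gamma>" using pool(1) by auto
    then have "t \<circ> t' = pinv (v \<circ> u)"
      using uv(3,4) o_inv_distrib permutes_bij[OF perm] by metis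
    then show "sifts L W 0 (t \<circ> t')" using pairs uv by simp
  qed simp
  have pow: "sifts L W 0 (h ^^ m)" if "sifts L W 0 h" for h m
  proof (induction m)
    case 0
    show ?case unfolding funpow.simps by (rule sifts_id_below) simp
  next
    case (Suc m)
    show ?case unfolding funpow.simps by (rule comp[OF that Suc])
  qed
  have sifts_pinv: "sifts L W 0 (pinv h)" if h: "sifts L W 0 h" "h \<in> \<Gamma>" for h
  proof -
    have "permutation h" using perm[OF h(2)] by (auto simp: permutation_permutes)
    then obtain m where m: "h ^^ m = id" "m > 0" using permutation_is_nilpotent by blast
    then have "h ^^ (m - 1) \<circ> h = id"
      by (metis Suc_pred' funpow_Suc_right One_nat_def)
    then have "pinv h = h ^^ (m - 1)"
      by (metis inv_unique_comp funpow_Suc_right funpow.simps(2))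
    then show ?thesis using pow[OF h(1)] by simp
  qed
  have G: "sifts L W 0 h" if "h \<in> G" for h
  proof -
    have h: "h \<in> X" "h \<in> \<Gamma>" using that pool by auto
    have "sifts L W 0 (pinv h)" using pairs[OF pool(2) h(1)] by simp
    then have "sifts L W 0 (pinv (pinv h))" using sifts_pinv pinv_in h by blast
    then show ?thesis using inv_inv_eq permutes_bij[OF perm[OF h(2)]] by metis
  qed
  have "g \<in> generate (sym_group n) G" using g gen by simp
  then show ?thesis
  proof (induction rule: generate.induct)
    case one
    have "one (sym_group n) = id" by (simp add: sym_group_def)
    then show ?case using sifts_id_below le0 by metis
  next
    case (incl h)
    then show ?case by (rule G)
  next
    case (inv h)
    then have "h \<in> \<Gamma>" using pool by auto
    then have "m_inv (sym_group n) h = pinv h"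
      using perm by (intro sym_group_inv_equality) (auto simp: sym_group_def)
    then show ?case using \<open>h \<in> \<Gamma>\<close> inv G sifts_pinv by simp
  next
    case (eng h1 h2)
    moreover have "mult (sym_group n) h1 h2 = h1 \<circ> h2" by (simp add: sym_group_def)
    ultimately show ?case using comp by metis
  qed
qed

lemma sifts_orbit:
  assumes "sifts L W 0 g" "k < n" "\<And>i. i < k \<Longrightarrow> g (L ! i) = L ! i" "g (L ! k) \<noteq> L ! k"
  shows "W k (g (L ! k)) \<noteq> None"
proof -
  have "sifts L W k g" using sifts_raise assms by simp
  then show ?thesis using assms by cases (auto simp: length_L)
qed

end

section \<open>Moving a vector into the cone of the cuts\<close>

text \<open>
  The pointwise stabilizer of the first \<open>k\<close> leaders, written \<open>\<Gamma>\<^sub>k\<close> above. By \<open>sst_state_invariant\<close> it is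
  the current group of the SST algorithm when leader \<open>k\<close> is selected.
\<close>

definition level_group :: "nat \<Rightarrow> (nat \<Rightarrow> nat) set" where
  "level_group k = stab \<Gamma> (set (take k L))"

lemma level_group_iff: 
  assumes "k \<le> n" shows "g \<in> level_group k \<longleftrightarrow> g \<in> \<Gamma> \<and> (\<forall>i<k. g (L ! i) = L ! i)"
proof -
  have "set (take k L) = (!) L ` {..<k}"
    using assms length_L nth_image[of k L] by (simp add: lessThan_atLeast0)
  then show ?thesis by (auto simp: level_group_def stab_def)
qed

text \<open>
  The vector \<open>x\<close> satisfies the cuts of the first \<open>k\<close> leaders.
\<close>

definition cuts_hold :: "nat \<Rightarrow> (nat \<Rightarrow> real) \<Rightarrow> bool" where
  "cuts_hold k x \<longleftrightarrow> (\<forall>i<k. \<forall>f\<in>orb (L ! i) (level_group i). x f \<le> x (L ! i))"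

lemma cuts_hold_step:
  assumes k: "k < n" and x: "cuts_hold k x" and u: "u \<in> level_group k" "u j = L ! k"
    and max: "\<And>f. f \<in> orb (L ! k) (level_group k) \<Longrightarrow> x f \<le> x j"
  shows "cuts_hold (Suc k) (perm_act u x)"
  unfolding cuts_hold_def
proof (intro allI impI ballI)
  fix i f assume i: "i < Suc k" and "f \<in> orb (L ! i) (level_group i)"
  then obtain g where g: "g \<in> level_group i" "f = g (L ! i)" by (auto simp: orb_def)
  have u\<Gamma>: "u \<in> \<Gamma>" "\<And>i. i < k \<Longrightarrow> u (L ! i) = L ! i" using u k level_group_iff by auto
  note inv_simps = permutes_inverses[OF perm[OF u\<Gamma>(1)]]
  have "pinv u (L ! i') = L ! i'" if "i' < i" for i'
    using u\<Gamma>(2)[of i'] that i inv_simps(2) by (metis less_SucE less_trans)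
  then have "pinv u \<circ> g \<in> level_group i"
    using g pinv_in[OF u\<Gamma>(1)] comp_in i k by (auto simp: level_group_iff)
  then have f: "pinv u f \<in> orb (L ! i) (level_group i)" unfolding orb_def mem_Collect_eq
    by (intro exI[of _ "pinv u \<circ> g"]) (simp add: g(2))
  show "perm_act u x f \<le> perm_act u x (L ! i)"
  proof (cases "i = k")
    case True
    then have "pinv u (L ! i) = j" using u(2) inv_simps(2) by metis
    then show ?thesis using max f True by (simp add: perm_act_def)
  next
    case False
    then have "pinv u (L ! i) = L ! i" using u\<Gamma>(2)[of i] i inv_simps(2) by (metis less_SucE)
    then show ?thesis using x f False i by (simp add: perm_act_def cuts_hold_def)
  qed
qed

lemma finite_level_orbit: "k < n \<Longrightarrow> finite (orb (L ! k) (level_group k))"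
proof (rule finite_subset[of _ "{1..n}"])
  assume "k < n"
  then show "orb (L ! k) (level_group k) \<subseteq> {1..n}"
    using level_group_iff[of k] L_in[of k] permutes_in_image[OF perm] by (auto simp: orb_def simp del: atLeastAtMost_iff)
qed simp

text \<open>
  This transfers unboundedness of the program to the program with the cuts, where no optimal
  point is available to be moved.
\<close>

lemma exists_cuts_hold:
  assumes sym: "\<And>u y. u \<in> \<Gamma> \<Longrightarrow> P y \<Longrightarrow> P (perm_act u y)" and "P x" "k \<le> n"
  shows "\<exists>y. P y \<and> cuts_hold k y"
  using assms(3)
proof (induction k)
  case 0
  show ?case using assms(2) by (auto simp: cuts_hold_def)
next
  case (Suc k)
  then obtain y where y: "P y" "cuts_hold k y" by auto
  let ?O = "orb (L ! k) (level_group k)"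
  have id: "id \<in> level_group k" using Suc.prems id_in by (simp add: level_group_iff)
  then have "?O \<noteq> {}" by (auto simp: orb_def)
  moreover have "finite ?O" using finite_level_orbit Suc.prems by simp
  ultimately have "Max (y ` ?O) \<in> y ` ?O" "\<And>f. f \<in> ?O \<Longrightarrow> y f \<le> Max (y ` ?O)" by simp_all
  then obtain j where j: "j \<in> ?O" "\<And>f. f \<in> ?O \<Longrightarrow> y f \<le> y j" by (metis imageE)
  then obtain g where g: "g \<in> level_group k" "j = g (L ! k)" by (auto simp: orb_def)
  then have g\<Gamma>: "g \<in> \<Gamma>" "\<And>i. i < k \<Longrightarrow> g (L ! i) = L ! i"
    using Suc.prems by (auto simp: level_group_iff)
  note inv_simps = permutes_inverses(2)[OF perm[OF g\<Gamma>(1)]]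
  have "pinv g \<in> level_group k"
    using Suc.prems pinv_in[OF g\<Gamma>(1)] g\<Gamma>(2) inv_simps by (simp add: level_group_iff) metis
  moreover have "pinv g j = L ! k" using g(2) inv_simps by simp
  ultimately have "cuts_hold (Suc k) (perm_act (pinv g) y)"
    using cuts_hold_step y(2) j(2) Suc.prems by simp
  then show ?case using sym[OF pinv_in[OF g\<Gamma>(1)] y(1)] by blast
qed

end

section \<open>The output of the SST algorithm\<close>

lemma sst_state_invariant:
  assumes "sst_state n \<Gamma> \<Gamma>' L Orb"
  shows "\<Gamma>' = stab \<Gamma> (set L) \<and> distinct L \<and> set L \<subseteq> {1..n} \<and>
    (\<forall>k<length L. Orb (L ! k) = orb (L ! k) (stab \<Gamma> (set (take k L))))"
  using assms
proof induction
  case init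
  then show ?case by (simp add: stab_def)
next
  case (step \<Gamma>' L Orb l)
  have "(Orb(l := orb l \<Gamma>')) ((L @ [l]) ! k) =
      orb ((L @ [l]) ! k) (stab \<Gamma> (set (take k (L @ [l]))))" if "k < length (L @ [l])" for k
  proof (cases "k = length L")
    case False
    then have "k < length L" using that by simp
    moreover then have "L ! k \<noteq> l" using step.hyps nth_mem by fastforce
    ultimately show ?thesis using step.IH by (simp add: nth_append)
  qed (use step.IH in simp)
  moreover have "stab \<Gamma>' (set (L @ [l])) = stab \<Gamma> (set (L @ [l]))"
    using step.IH by (auto simp: stab_def)
  ultimately show ?case using step.IH step.hyps by simp
qed

lemma sst_output_group:
  assumes "subgroup \<Gamma> (sym_group n)" "sst_output n \<Gamma> L Orb"
  shows "sst_group n \<Gamma> L"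
proof -
  obtain \<Gamma>' where state: "sst_state n \<Gamma> \<Gamma>' L Orb" and all: "{1..n} \<subseteq> set L"
    using assms(2) unfolding sst_output_def by blast
  have "distinct L" "set L \<subseteq> {1..n}" using sst_state_invariant[OF state] by simp_all
  then show ?thesis using assms(1) all by (intro sst_group.intro equalityI)
qed

lemma cut_cone_iff_cuts_hold:
  assumes "subgroup \<Gamma> (sym_group n)" "sst_output n \<Gamma> L Orb" "x \<in> real_vectors n"
  shows "x \<in> cut_cone n (sst_cuts L Orb) \<longleftrightarrow> sst_group.cuts_hold \<Gamma> L n x"
proof -
  interpret sst_group n \<Gamma> L using assms(1,2) by (rule sst_output_group)
  have Orb: "\<And>k. k < n \<Longrightarrow> Orb (L ! k) = orb (L ! k) (level_group k)"
    using assms(2) sst_state_invariant length_L unfolding sst_output_def level_group_def by blast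
  have "x \<in> cut_cone n (sst_cuts L Orb) \<longleftrightarrow> (\<forall>l\<in>set L. \<forall>f\<in>Orb l. x f \<le> x l)"
    using assms(3) by (auto simp: cut_cone_def sst_cuts_def)
  also have "\<dots> \<longleftrightarrow> cuts_hold n x"
    unfolding all_set_conv_all_nth cuts_hold_def length_L using Orb by simp
  finally show ?thesis .
qed

section \<open>Timed execution of programs\<close>

text \<open>
  Total correctness with a time bound: started in \<open>s\<close>, the program \<open>C\<close> terminates after at most \<open>t\<close>
  steps in a state that satisfies \<open>Q\<close>.
\<close>

definition runs :: "com \<Rightarrow> store \<Rightarrow> nat \<Rightarrow> (store \<Rightarrow> bool) \<Rightarrow> bool" where
  "runs C s t Q \<longleftrightarrow> (\<exists>t' s'. exec C s t' s' \<and> t' \<le> t \<and> Q s')"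

lemma runs_mono: "runs C s t Q \<Longrightarrow> t \<le> t' \<Longrightarrow> (\<And>s'. Q s' \<Longrightarrow> Q' s') \<Longrightarrow> runs C s t' Q'"
  unfolding runs_def by (meson le_trans)

lemma runs_Skip: "Q s \<Longrightarrow> 1 \<le> t \<Longrightarrow> runs Skip s t Q"
  unfolding runs_def using exec.Skip by blast

lemma runs_Assign:
  "Q (s(v := (s v)(aval i s := aval e s))) \<Longrightarrow> acost i + acost e + 1 \<le> t \<Longrightarrow>
    runs (Assign v i e) s t Q"
  unfolding runs_def using exec.Assign by blast

lemma runs_Seq:
  assumes "runs C1 s t1 (\<lambda>s1. runs C2 s1 t2 Q)" "t1 + t2 \<le> t"
  shows "runs (Seq C1 C2) s t Q"
proof -
  obtain t1' s1 t2' s2 where "exec C1 s t1' s1" "t1' \<le> t1" "exec C2 s1 t2' s2" "t2' \<le> t2" "Q s2"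
    using assms(1) unfolding runs_def by blast
  moreover then have "t1' + t2' \<le> t" using assms(2) by simp
  ultimately show ?thesis unfolding runs_def using exec.Seq by blast
qed

lemma runs_Assign_Seq:
  assumes "runs C (s(v := (s v)(aval i s := aval e s))) t1 Q" "acost i + acost e + 1 + t1 \<le> t"
  shows "runs (Seq (Assign v i e) C) s t Q"
  using assms by (intro runs_Seq[where ?t1.0 = "acost i + acost e + 1"] runs_Assign) auto

lemma runs_If:
  assumes "bval g s \<Longrightarrow> runs C1 s t1 Q" "\<not> bval g s \<Longrightarrow> runs C2 s t1 Q" "bcost g + 1 + t1 \<le> t"
  shows "runs (If g C1 C2) s t Q"
proof (cases "bval g s")
  case True
  then obtain t' s' where "exec C1 s t' s'" "t' \<le> t1" "Q s'"
    using assms(1) unfolding runs_def by blast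
  then show ?thesis unfolding runs_def using exec.IfTrue[OF True] assms(3)
    by (intro exI[of _ "bcost g + 1 + t'"] exI[of _ s']) auto
next
  case False
  then obtain t' s' where "exec C2 s t' s'" "t' \<le> t1" "Q s'"
    using assms(2) unfolding runs_def by blast
  then show ?thesis unfolding runs_def using exec.IfFalse[OF False] assms(3)
    by (intro exI[of _ "bcost g + 1 + t'"] exI[of _ s']) auto
qed

text \<open>
  The first argument of the invariant bounds the number of remaining iterations.
\<close>

lemma runs_While:
  assumes "I m s"
    and step: "\<And>m s. I m s \<Longrightarrow> bval g s \<Longrightarrow> 0 < m \<and> runs C s tc (I (m - 1))"
    and exit: "\<And>m s. I m s \<Longrightarrow> \<not> bval g s \<Longrightarrow> Q s"
    and "m * (bcost g + 1 + tc) + bcost g + 1 \<le> t"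
  shows "runs (While g C) s t Q"
  using assms(1,4)
proof (induction m arbitrary: s t)
  case 0
  then have "\<not> bval g s" using step by blast
  then show ?case using exit[OF 0(1)] exec.WhileFalse[of g s C] 0(2) unfolding runs_def by auto
next
  case (Suc m)
  show ?case
  proof (cases "bval g s")
    case True
    then obtain t1 s1 where 1: "exec C s t1 s1" "t1 \<le> tc" "I m s1"
      using step[OF Suc.prems(1)] unfolding runs_def by auto
    obtain t2 s2 where 2: "exec (While g C) s1 t2 s2" "t2 \<le> m * (bcost g + 1 + tc) + bcost g + 1" "Q s2"
      using Suc.IH[OF 1(3) le_refl] unfolding runs_def by auto
    have "bcost g + 1 + t1 + t2 \<le> t" using 1(2) 2(2) Suc.prems(2) by simp
    then show ?thesis using exec.WhileTrue[OF True 1(1) 2(1)] 2(3) unfolding runs_def by blast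
  next
    case False
    then show ?thesis
      using exit[OF Suc.prems(1)] exec.WhileFalse[of g s C] Suc.prems(2) unfolding runs_def
      by (intro exI[of _ "bcost g + 1"] exI[of _ s]) auto
  qed
qed

abbreviation var :: "string \<Rightarrow> aexp" where
  "var v \<equiv> Read v (Const 0)"

abbreviation set_var :: "string \<Rightarrow> aexp \<Rightarrow> com" where
  "set_var v e \<equiv> Assign v (Const 0) e"

definition Eq :: "aexp \<Rightarrow> aexp \<Rightarrow> bexp" where
  "Eq e1 e2 = Conj (Neg (Less e1 e2)) (Neg (Less e2 e1))"

lemma bval_Eq [simp]: "bval (Eq e1 e2) s \<longleftrightarrow> aval e1 s = aval e2 s"
  by (auto simp: Eq_def)

lemma bcost_Eq [simp]: "bcost (Eq e1 e2) = 2 * (acost e1 + acost e2) + 5"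
  by (simp add: Eq_def)

text \<open>
  A loop over \<open>v = 1, \<dots>, n\<close>, where \<open>n\<close> is read from the variable \<open>nn\<close>.
\<close>

definition For :: "string \<Rightarrow> com \<Rightarrow> com" where
  "For v C = Seq (set_var v (Const 1))
     (While (Neg (Less (var ''nn'') (var v))) (Seq C (set_var v (Plus (var v) (Const 1)))))"

lemma runs_For:
  assumes init: "I 0 (s(v := (s v)(0 := 1)))"
    and nn: "s ''nn'' 0 = int n" "v \<noteq> ''nn''"
    and step: "\<And>k s. k < n \<Longrightarrow> I k s \<Longrightarrow> s v 0 = int k + 1 \<Longrightarrow> s ''nn'' 0 = int n \<Longrightarrow>
      runs C s tc (\<lambda>s'. s' v 0 = int k + 1 \<and> s' ''nn'' 0 = int n \<and>
        I (Suc k) (s'(v := (s' v)(0 := 2 + int k))))"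
    and exit: "\<And>s. I n s \<Longrightarrow> Q s"
    and t: "n * (tc + 13) + 10 \<le> t"
  shows "runs (For v C) s t Q"
proof -
  let ?J = "\<lambda>m s. \<exists>k. k \<le> n \<and> m = n - k \<and> I k s \<and> s v 0 = int k + 1 \<and> s ''nn'' 0 = int n"
  show ?thesis
    unfolding For_def
  proof (rule runs_Seq[where ?t1.0 = 3 and ?t2.0 = "n * (tc + 13) + 7"], rule runs_Assign)
    show "runs (While (Neg (Less (var ''nn'') (var v))) (Seq C (set_var v (Plus (var v) (Const 1)))))
        (s(v := (s v)(aval (Const 0) s := aval (Const 1) s))) (n * (tc + 13) + 7) Q"
    proof (rule runs_While[where I = ?J and m = n and tc = "tc + 6"])
      show "?J n (s(v := (s v)(aval (Const 0) s := aval (Const 1) s)))"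
        using init nn by (intro exI[of _ 0]) simp
    next
      fix m s assume J: "?J m s" and b: "bval (Neg (Less (var ''nn'') (var v))) s"
      then obtain k where k: "k < n" "m = n - k" "I k s" "s v 0 = int k + 1" "s ''nn'' 0 = int n"
        by auto
      have "runs (Seq C (set_var v (Plus (var v) (Const 1)))) s (tc + 6) (?J (m - 1))"
      proof (rule runs_Seq[where ?t1.0 = tc and ?t2.0 = 6], rule runs_mono[OF step[OF k(1,3,4,5)]])
        fix s' assume s': "s' v 0 = int k + 1 \<and> s' ''nn'' 0 = int n \<and>
          I (Suc k) (s'(v := (s' v)(0 := 2 + int k)))"
        then have e: "s' v 0 + 1 = 2 + int k" by simp
        show "runs (set_var v (Plus (var v) (Const 1))) s' 6 (?J (m - 1))"
          by (rule runs_Assign) (use s' k nn(2) in \<open>auto simp: e intro!: exI[of _ "Suc k"]\<close>)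
      qed simp_all
      then show "0 < m \<and> runs (Seq C (set_var v (Plus (var v) (Const 1)))) s (tc + 6) (?J (m - 1))"
        using k by simp
    next
      fix m s assume J: "?J m s" and b: "\<not> bval (Neg (Less (var ''nn'') (var v))) s"
      then obtain k where "k \<le> n" "I k s" "s v 0 = int k + 1" "s ''nn'' 0 = int n" by auto
      moreover then have "k = n" using b by simp
      ultimately show "Q s" using exit by simp
    qed (simp add: algebra_simps)
  qed (use t in simp_all)
qed

text \<open>
  The effect of \<open>A[p k] := w k\<close> for \<open>k = 1, \<dots>, n\<close>. The expressions are evaluated in a state in which
  the cells \<open>p 1, \<dots>, p (k - 1)\<close> of \<open>A\<close> may have been overwritten already; \<open>w\<close> may still refer to
  the other cells of \<open>A\<close>, so that an array can be updated in place.
\<close>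

lemma runs_scatter:
  fixes p w :: "nat \<Rightarrow> int"
  assumes nn: "s ''nn'' 0 = int n" and names: "v \<noteq> ''nn''" "A \<noteq> ''nn''" "v \<noteq> A"
    and inj: "inj_on p {1..n}"
    and eval: "\<And>k s'. k \<in> {1..n} \<Longrightarrow> (\<And>x. x \<noteq> v \<Longrightarrow> x \<noteq> A \<Longrightarrow> s' x = s x) \<Longrightarrow>
      s' v 0 = int k \<Longrightarrow> (\<And>z. z \<notin> p ` {1..<k} \<Longrightarrow> s' A z = s A z) \<Longrightarrow>
      aval e1 s' = p k \<and> aval e2 s' = w k"
    and exit: "\<And>s'. (\<And>x. x \<noteq> v \<Longrightarrow> x \<noteq> A \<Longrightarrow> s' x = s x) \<Longrightarrow>
      (\<And>k. k \<in> {1..n} \<Longrightarrow> s' A (p k) = w k) \<Longrightarrow>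
      (\<And>z. z \<notin> p ` {1..n} \<Longrightarrow> s' A z = s A z) \<Longrightarrow> Q s'"
    and t: "n * (acost e1 + acost e2 + 14) + 10 \<le> t"
  shows "runs (For v (Assign A e1 e2)) s t Q"
proof -
  define I where "I k s' \<longleftrightarrow> (\<forall>x. x \<noteq> v \<longrightarrow> x \<noteq> A \<longrightarrow> s' x = s x) \<and>
    (\<forall>i\<in>{1..k}. s' A (p i) = w i) \<and> (\<forall>z. z \<notin> p ` {1..k} \<longrightarrow> s' A z = s A z)" for k s'
  show ?thesis
  proof (rule runs_For[where I = I and n = n and tc = "acost e1 + acost e2 + 1"])
    show "I 0 (s(v := (s v)(0 := 1)))" using names by (simp add: I_def)
  next
    fix k s' assume k: "k < n" and I: "I k s'" and v: "s' v 0 = int k + 1" "s' ''nn'' 0 = int n"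
    have ev: "aval e1 s' = p (Suc k) \<and> aval e2 s' = w (Suc k)"
      by (rule eval) (use k I v names in \<open>auto simp: I_def atLeastLessThanSuc_atLeastAtMost\<close>)
    have ne: "p (Suc k) \<noteq> p i" if "i \<in> {1..k}" for i
      using inj_onD[OF inj, of "Suc k" i] that k by auto
    have set: "{1..Suc k} = insert (Suc k) {1..k}" by auto
    show "runs (Assign A e1 e2) s' (acost e1 + acost e2 + 1) (\<lambda>s'. s' v 0 = int k + 1 \<and>
        s' ''nn'' 0 = int n \<and> I (Suc k) (s'(v := (s' v)(0 := 2 + int k))))"
    proof (rule runs_Assign)
      let ?s = "s'(A := (s' A)(aval e1 s' := aval e2 s'))"
      have "I (Suc k) (?s(v := (?s v)(0 := 2 + int k)))"
        using I ne names ev unfolding I_def set by (auto simp: eq_commute[of "p (Suc k)"])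
      then show "?s v 0 = int k + 1 \<and> ?s ''nn'' 0 = int n \<and> I (Suc k) (?s(v := (?s v)(0 := 2 + int k)))"
        using v names by simp
    qed simp
  next
    fix s' assume "I n s'"
    then show "Q s'" by (intro exit) (auto simp: I_def)
  qed (use nn names t in \<open>simp_all add: algebra_simps\<close>)
qed

section \<open>Renaming the arrays of a program\<close>

fun rename_aexp :: "(string \<Rightarrow> string) \<Rightarrow> aexp \<Rightarrow> aexp" where
  "rename_aexp \<rho> (Const k) = Const k"
| "rename_aexp \<rho> (Read v e) = Read (\<rho> v) (rename_aexp \<rho> e)"
| "rename_aexp \<rho> (Plus e1 e2) = Plus (rename_aexp \<rho> e1) (rename_aexp \<rho> e2)"
| "rename_aexp \<rho> (Minus e1 e2) = Minus (rename_aexp \<rho> e1) (rename_aexp \<rho> e2)"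

fun rename_bexp :: "(string \<Rightarrow> string) \<Rightarrow> bexp \<Rightarrow> bexp" where
  "rename_bexp \<rho> (Less e1 e2) = Less (rename_aexp \<rho> e1) (rename_aexp \<rho> e2)"
| "rename_bexp \<rho> (Neg g) = Neg (rename_bexp \<rho> g)"
| "rename_bexp \<rho> (Conj g1 g2) = Conj (rename_bexp \<rho> g1) (rename_bexp \<rho> g2)"

fun rename_com :: "(string \<Rightarrow> string) \<Rightarrow> com \<Rightarrow> com" where
  "rename_com \<rho> Skip = Skip"
| "rename_com \<rho> (Assign v e1 e2) = Assign (\<rho> v) (rename_aexp \<rho> e1) (rename_aexp \<rho> e2)"
| "rename_com \<rho> (Seq C1 C2) = Seq (rename_com \<rho> C1) (rename_com \<rho> C2)"
| "rename_com \<rho> (If g C1 C2) = If (rename_bexp \<rho> g) (rename_com \<rho> C1) (rename_com \<rho> C2)"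
| "rename_com \<rho> (While g C) = While (rename_bexp \<rho> g) (rename_com \<rho> C)"

lemma aval_rename [simp]: "aval (rename_aexp \<rho> e) z = aval e (\<lambda>v. z (\<rho> v))"
  by (induction e) auto

lemma acost_rename [simp]: "acost (rename_aexp \<rho> e) = acost e"
  by (induction e) auto

lemma bval_rename [simp]: "bval (rename_bexp \<rho> g) z \<longleftrightarrow> bval g (\<lambda>v. z (\<rho> v))"
  by (induction g) auto

lemma bcost_rename [simp]: "bcost (rename_bexp \<rho> g) = bcost g"
  by (induction g) auto

lemma exec_rename:
  assumes "exec C s t s'" "inj \<rho>" "(\<lambda>v. z (\<rho> v)) = s"
  shows "\<exists>z'. exec (rename_com \<rho> C) z t z' \<and> (\<lambda>v. z' (\<rho> v)) = s' \<and> (\<forall>v. v \<notin> range \<rho> \<longrightarrow> z' v = z v)"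
  using assms(1,3)
proof (induction arbitrary: z)
  case (Skip s)
  then show ?case using exec.Skip by auto
next
  case (Assign v i e s)
  let ?z' = "z(\<rho> v := (z (\<rho> v))(aval i s := aval e s))"
  have "exec (rename_com \<rho> (Assign v i e)) z (acost i + acost e + 1) ?z'"
    using exec.Assign[of "\<rho> v" "rename_aexp \<rho> i" "rename_aexp \<rho> e" z] Assign by simp
  moreover have "(\<lambda>v. ?z' (\<rho> v)) = s(v := (s v)(aval i s := aval e s))"
    using Assign assms(2) by (auto simp: fun_eq_iff inj_eq)
  moreover have "\<forall>v. v \<notin> range \<rho> \<longrightarrow> ?z' v = z v" by auto
  ultimately show ?case by blast
next
  case (Seq C1 s t1 s1 C2 t2 s2)
  obtain z1 where 1: "exec (rename_com \<rho> C1) z t1 z1" "(\<lambda>v. z1 (\<rho> v)) = s1" "\<forall>v. v \<notin> range \<rho> \<longrightarrow> z1 v = z v"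
    using Seq.IH(1)[OF Seq.prems] by auto
  obtain z2 where "exec (rename_com \<rho> C2) z1 t2 z2" "(\<lambda>v. z2 (\<rho> v)) = s2" "\<forall>v. v \<notin> range \<rho> \<longrightarrow> z2 v = z1 v"
    using Seq.IH(2)[OF 1(2)] by auto
  then show ?case using exec.Seq[OF 1(1)] 1(3) by (intro exI[of _ z2]) auto
next
  case (IfTrue g s C1 t s1 C2)
  then show ?case using exec.IfTrue[of "rename_bexp \<rho> g" z "rename_com \<rho> C1" t]
    by simp blast
next
  case (IfFalse g s C2 t s1 C1)
  then show ?case using exec.IfFalse[of "rename_bexp \<rho> g" z "rename_com \<rho> C2" t]
    by simp blast
next
  case (WhileFalse g s C)
  then show ?case using exec.WhileFalse[of "rename_bexp \<rho> g" z] by auto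
next
  case (WhileTrue g s C t1 s1 t2 s2)
  obtain z1 where 1: "exec (rename_com \<rho> C) z t1 z1" "(\<lambda>v. z1 (\<rho> v)) = s1" "\<forall>v. v \<notin> range \<rho> \<longrightarrow> z1 v = z v"
    using WhileTrue.IH(1)[OF WhileTrue.prems] by auto
  obtain z2 where 2: "exec (rename_com \<rho> (While g C)) z1 t2 z2" "(\<lambda>v. z2 (\<rho> v)) = s2"
      "\<forall>v. v \<notin> range \<rho> \<longrightarrow> z2 v = z1 v"
    using WhileTrue.IH(2)[OF 1(2)] by auto
  have "exec (rename_com \<rho> (While g C)) z (bcost g + 1 + t1 + t2) z2"
    using exec.WhileTrue[of "rename_bexp \<rho> g" z "rename_com \<rho> C" t1 z1 t2 z2]
      WhileTrue.hyps WhileTrue.prems 1(1) 2(1) by simp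
  then show ?case using 1(3) 2 by (intro exI[of _ z2]) auto
qed

section \<open>Programs for sifting\<close>

text \<open>
  The permutations of the pool are stored in consecutive blocks of \<open>n\<close> cells of the array \<open>gens\<close>,
  which initially contains the generators; \<open>top\<close> is the number of cells in use. The permutation in
  the block at offset \<open>a\<close> maps \<open>i\<close> to the content of cell \<open>a + i\<close>. Cell \<open>n * k + j\<close> of the array
  \<open>D\<close> contains the offset of table entry \<open>(k, j)\<close>, or 0 if there is none; the block at offset 0 is
  never a table entry. The permutation to be sifted is in the array \<open>cur\<close>, and \<open>row\<close> is
  \<open>n * k\<close> at level \<open>k\<close>, which avoids multiplications.
  
  \<open>inv_prod_cmd a b\<close> computes the inverse of the product of two blocks: it assigns \<open>i\<close> to the cell
  with the image of \<open>i\<close> as its index.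
\<close>

definition inv_prod_cmd :: "string \<Rightarrow> string \<Rightarrow> com" where
  "inv_prod_cmd a b = For ''i'' (Assign ''cur''
     (Read ''gens'' (Plus (var b) (Read ''gens'' (Plus (var a) (var ''i''))))) (var ''i''))"

text \<open>
  Append the inverse of the permutation in \<open>cur\<close> to the pool and enter it into the table.
\<close>

definition store_cmd :: com where
  "store_cmd = Seq (Assign ''D'' (Plus (var ''row'') (var ''j'')) (var ''top''))
     (Seq (For ''i'' (Assign ''gens'' (Plus (var ''top'') (Read ''cur'' (var ''i''))) (var ''i'')))
          (set_var ''top'' (Plus (var ''top'') (var ''nn''))))"

text \<open>
  Multiply the permutation in \<open>cur\<close> by a table entry.
\<close>

definition apply_cmd :: com where
  "apply_cmd = Seq (set_var ''d'' (Read ''D'' (Plus (var ''row'') (var ''j''))))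
     (For ''i'' (Assign ''cur'' (var ''i'') (Read ''gens'' (Plus (var ''d'') (Read ''cur'' (var ''i''))))))"

text \<open>
  Sift through one level. After an empty entry has been filled, \<open>apply_cmd\<close> turns \<open>cur\<close> into the identity, so that the remaining
  levels have no effect and no early exit is needed.
\<close>

definition level_cmd :: com where
  "level_cmd = Seq (set_var ''l'' (Read ''leaders'' (var ''k'')))
     (Seq (set_var ''j'' (Read ''cur'' (var ''l'')))
     (Seq (If (Eq (var ''j'') (var ''l'')) Skip
             (Seq (If (Eq (Read ''D'' (Plus (var ''row'') (var ''j''))) (Const 0)) store_cmd Skip)
                  apply_cmd))
          (set_var ''row'' (Plus (var ''row'') (var ''nn'')))))"

definition sift_cmd :: com where
  "sift_cmd = Seq (set_var ''row'' (Const 0)) (For ''k'' level_cmd)"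

text \<open>
  Bounds on running times, with generous constants; \<open>loop_time\<close> is one for the loops over \<open>1, \<dots>, n\<close>
  whose body is a single assignment.
\<close>

definition loop_time :: "nat \<Rightarrow> nat" where "loop_time n = 30 * n + 10"

definition level_time :: "nat \<Rightarrow> nat" where "level_time n = 2 * loop_time n + 120"

definition sift_time :: "nat \<Rightarrow> nat" where "sift_time n = n * (level_time n + 13) + 20"

lemma block_inj:
  assumes "i \<in> {1..n}" "i' \<in> {1..n}" "int n * int e + int i = int n * int e' + int i'"
  shows "e = e' \<and> i = i'"
proof -
  have *: "\<not> e < e'" if "i \<in> {1..n}" "i' \<in> {1..n}" "n * e + i = n * e' + i'" for e e' i i'
  proof
    assume "e < e'"
    then have "n * Suc e \<le> n * e'" by (intro mult_le_mono2) simp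
    then show False using that by auto
  qed
  have "n * e + i = n * e' + i'"
    using assms(3) by (metis of_nat_add of_nat_mult of_nat_eq_iff)
  then show ?thesis using *[OF assms(1,2)] *[OF assms(2,1)] by (metis add_left_cancel linorder_neqE_nat)
qed

text \<open>
  The array \<open>cur\<close> contains the permutation \<open>g\<close>.
\<close>

definition perm_in :: "nat \<Rightarrow> store \<Rightarrow> (nat \<Rightarrow> nat) \<Rightarrow> bool" where
  "perm_in n s g \<longleftrightarrow> (\<forall>i\<in>{1..n}. s ''cur'' (int i) = int (g i))"

text \<open>
  The table given by the pool \<open>us\<close> and the index \<open>U k j\<close> of entry \<open>(k, j)\<close> in it. Index 0, which is
  taken by a generator or the identity, encodes an absent entry.
\<close>

definition table :: "(nat \<Rightarrow> nat) list \<Rightarrow> (nat \<Rightarrow> nat \<Rightarrow> nat) \<Rightarrow> nat \<Rightarrow> nat \<Rightarrow> (nat \<Rightarrow> nat) option" where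
  "table us U k j = (if U k j = 0 then None else Some (us ! U k j))"

locale sst_run = sst_group +
  fixes G :: "(nat \<Rightarrow> nat) list"
  assumes gens: "set G \<subseteq> \<Gamma>" and generated: "\<Gamma> = generate (sym_group n) (set G)"
    and n_pos: "0 < n"
begin

text \<open>
  The state \<open>s\<close> represents the pool \<open>us\<close> and the table indices \<open>U\<close>, next to \<open>n\<close> and the leaders.
\<close>

definition stored :: "(nat \<Rightarrow> nat) list \<Rightarrow> (nat \<Rightarrow> nat \<Rightarrow> nat) \<Rightarrow> store \<Rightarrow> bool" where
  "stored us U s \<longleftrightarrow> s ''nn'' 0 = int n \<and> (\<forall>k<n. s ''leaders'' (int k + 1) = int (L ! k)) \<and>
     s ''top'' 0 = int n * int (length us) \<and>
     (\<forall>e<length us. \<forall>i\<in>{1..n}. s ''gens'' (int n * int e + int i) = int ((us ! e) i)) \<and>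
     (\<forall>k<n. \<forall>j\<in>{1..n}. s ''D'' (int n * int k + int j) = int n * int (U k j))"

text \<open>
  The last conjunct says that the pool has as many members as there are generators and filled table
  entries, and one more for the identity. This bounds its size (\<open>pool_length\<close>).
\<close>

definition pool_ok :: "(nat \<Rightarrow> nat) list \<Rightarrow> (nat \<Rightarrow> nat \<Rightarrow> nat) \<Rightarrow> bool" where
  "pool_ok us U \<longleftrightarrow> set us \<subseteq> \<Gamma> \<and> us \<noteq> [] \<and> valid_table (table us U) \<and>
     (\<forall>k j. U k j \<noteq> 0 \<longrightarrow> j \<in> {1..n} \<and> U k j < length us) \<and>
     length us = length G + 1 + card {q. U (fst q) (snd q) \<noteq> 0}"

text \<open>
  Pool members and table entries are only added, never changed. Therefore a permutation that sifts
  at some time also does so later.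
\<close>

definition extends ::
  "(nat \<Rightarrow> nat) list \<Rightarrow> (nat \<Rightarrow> nat \<Rightarrow> nat) \<Rightarrow> (nat \<Rightarrow> nat) list \<Rightarrow> (nat \<Rightarrow> nat \<Rightarrow> nat) \<Rightarrow> bool" where
  "extends us U us' U' \<longleftrightarrow> (\<exists>vs. us' = us @ vs) \<and> (\<forall>k j. U k j \<noteq> 0 \<longrightarrow> U' k j = U k j)"

lemma extends_refl: "extends us U us U"
  by (simp add: extends_def)

lemma extends_trans: "extends us U us' U' \<Longrightarrow> extends us' U' us'' U'' \<Longrightarrow> extends us U us'' U''"
  by (auto simp: extends_def)

lemma extends_nth: "extends us U us' U' \<Longrightarrow> e < length us \<Longrightarrow> us' ! e = us ! e"
  by (auto simp: extends_def nth_append)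

lemma extends_length: "extends us U us' U' \<Longrightarrow> length us \<le> length us'"
  by (auto simp: extends_def)

lemma extends_table:
  assumes "extends us U us' U'" "pool_ok us U" "table us U k j = Some u"
  shows "table us' U' k j = Some u"
proof -
  have "U k j \<noteq> 0" "us ! U k j = u" using assms(3) by (auto simp: table_def split: if_splits)
  moreover then have "U' k j = U k j" "U k j < length us"
    using assms(1,2) by (auto simp: extends_def pool_ok_def)
  ultimately show ?thesis using extends_nth[OF assms(1)] by (simp add: table_def)
qed

lemma sifts_extends:
  "extends us U us' U' \<Longrightarrow> pool_ok us U \<Longrightarrow> sifts L (table us U) k g \<Longrightarrow> sifts L (table us' U') k g"
  using sifts_mono extends_table by metis

lemma table_entry:
  assumes "pool_ok us U" "U k j \<noteq> 0"
  shows "k < n \<and> j \<in> {1..n} \<and> U k j < length us \<and> us ! U k j \<in> \<Gamma> \<and> (us ! U k j) j = L ! k \<and>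
    (\<forall>i<k. (us ! U k j) (L ! i) = L ! i)"
proof -
  have "table us U k j = Some (us ! U k j)" using assms(2) by (simp add: table_def)
  then show ?thesis using assms unfolding pool_ok_def valid_table_def by auto
qed

lemma filled_subset: "pool_ok us U \<Longrightarrow> {q. U (fst q) (snd q) \<noteq> 0} \<subseteq> {..<n} \<times> {1..n}"
  using table_entry[of us U] by (auto simp: mem_Times_iff simp del: atLeastAtMost_iff)

lemma filled_finite: "pool_ok us U \<Longrightarrow> finite {q. U (fst q) (snd q) \<noteq> 0}"
  using filled_subset finite_subset by blast

lemma pool_length: assumes "pool_ok us U" shows "length us \<le> length G + 1 + n * n"
proof -
  have "card {q. U (fst q) (snd q) \<noteq> 0} \<le> card ({..<n} \<times> {1..n})"
    using card_mono[OF _ filled_subset[OF assms]] by simp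
  then show ?thesis using assms by (simp add: pool_ok_def card_cartesian_product)
qed

lemma pool_ok_insert:
  assumes ok: "pool_ok us U" and g: "g \<in> \<Gamma>" and k: "k < n" "\<And>i. i < k \<Longrightarrow> g (L ! i) = L ! i"
    and j: "g (L ! k) \<noteq> L ! k" "U k (g (L ! k)) = 0"
  shows "pool_ok (us @ [pinv g]) (U(k := (U k)(g (L ! k) := length us)))" (is "pool_ok ?us ?U")
proof -
  note inv_simps = permutes_inverses(2)[OF perm[OF g]]
  have len: "length us \<noteq> 0" using ok by (simp add: pool_ok_def)
  have fixes_inv: "pinv g (L ! i) = L ! i" if "i < k" for i
    using k(2)[OF that] inv_simps by metis
  have valid: "valid_table (table ?us ?U)"
    unfolding valid_table_def
  proof (intro allI impI)
    fix k' j' u assume "table ?us ?U k' j' = Some u"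
    then have ne: "?U k' j' \<noteq> 0" and u: "u = ?us ! ?U k' j'"
      by (auto simp: table_def split: if_splits)
    show "u \<in> \<Gamma> \<and> k' < n \<and> j' \<noteq> L ! k' \<and> u j' = L ! k' \<and> (\<forall>i<k'. u (L ! i) = L ! i)"
    proof (cases "k' = k \<and> j' = g (L ! k)")
      case True
      then have "u = pinv g" using u by simp
      then show ?thesis using True k j(1) pinv_in[OF g] inv_simps fixes_inv by simp
    next
      case False
      then have U: "?U k' j' = U k' j'" by auto
      then have "U k' j' < length us" using ne ok by (auto simp: pool_ok_def)
      then have "table us U k' j' = Some u" using ne u U by (simp add: table_def nth_append)
      then show ?thesis using ok unfolding pool_ok_def valid_table_def by blast
    qed
  qed
  have "{q. ?U (fst q) (snd q) \<noteq> 0} = insert (k, g (L ! k)) {q. U (fst q) (snd q) \<noteq> 0}"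
    using len by (auto split: if_splits)
  then have card: "card {q. ?U (fst q) (snd q) \<noteq> 0} = Suc (card {q. U (fst q) (snd q) \<noteq> 0})"
    using filled_finite[OF ok] j(2) by simp
  have "j' \<in> {1..n} \<and> ?U k' j' < length ?us" if "?U k' j' \<noteq> 0" for k' j'
  proof (cases "k' = k \<and> j' = g (L ! k)")
    case True
    then show ?thesis using permutes_in_image[OF perm[OF g]] L_in[OF k(1)]
      by (simp del: atLeastAtMost_iff)
  next
    case False
    then have U: "?U k' j' = U k' j'" by auto
    then have "j' \<in> {1..n} \<and> U k' j' < length us" using that ok unfolding pool_ok_def by metis
    then show ?thesis using U by simp
  qed
  then show ?thesis using ok valid card pinv_in[OF g] unfolding pool_ok_def by simp
qed

lemma stored_cong:
  assumes "stored us U s" "\<And>x. x \<in> {''nn'', ''leaders'', ''top'', ''gens'', ''D''} \<Longrightarrow> s' x = s x"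
  shows "stored us U s'"
  using assms by (simp add: stored_def)

lemma in_range: "g \<in> \<Gamma> \<Longrightarrow> i \<in> {1..n} \<Longrightarrow> g i \<in> {1..n}"
  using permutes_in_image[OF perm] by blast

lemma inj_on_perm: "g \<in> \<Gamma> \<Longrightarrow> inj_on g A"
  using permutes_inj[OF perm] by (auto simp: inj_on_def inj_def)

lemma runs_inv_prod:
  assumes st: "stored us U s" and ok: "pool_ok us U" and e: "e < length us" "e' < length us"
    and ab: "s a 0 = int n * int e" "s b 0 = int n * int e'" "a \<notin> {''i'', ''cur''}" "b \<notin> {''i'', ''cur''}"
    and exit: "\<And>s'. (\<And>x. x \<notin> {''i'', ''cur''} \<Longrightarrow> s' x = s x) \<Longrightarrow>
      perm_in n s' (pinv (us ! e' \<circ> us ! e)) \<Longrightarrow> Q s'"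
  shows "runs (inv_prod_cmd a b) s (loop_time n) Q"
  unfolding inv_prod_cmd_def
proof (rule runs_scatter[where n = n and w = int and p = "\<lambda>i. int ((us ! e') ((us ! e) i))"])
  have u: "us ! e \<in> \<Gamma>" "us ! e' \<in> \<Gamma>" using ok e by (auto simp: pool_ok_def)
  note range = in_range[OF u(1)] in_range[OF u(2)]
  show "inj_on (\<lambda>i. int ((us ! e') ((us ! e) i))) {1..n}"
    using inj_on_perm[OF comp_in[OF u(2,1)], of "{1..n}"]
    unfolding inj_on_def comp_apply of_nat_eq_iff .
  show "aval (Read ''gens'' (Plus (var b) (Read ''gens'' (Plus (var a) (var ''i''))))) s' =
      int ((us ! e') ((us ! e) k)) \<and> aval (var ''i'') s' = int k"
    if k: "k \<in> {1..n}" and frame: "\<And>x. x \<noteq> ''i'' \<Longrightarrow> x \<noteq> ''cur'' \<Longrightarrow> s' x = s x"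
      and i: "s' ''i'' 0 = int k" for k s'
  proof -
    have "s ''gens'' (int n * int e + int k) = int ((us ! e) k)"
      using st e(1) k by (simp add: stored_def)
    moreover have "s ''gens'' (int n * int e' + int ((us ! e) k)) = int ((us ! e') ((us ! e) k))"
      using st e(2) range(1)[OF k] by (simp add: stored_def)
    ultimately show ?thesis using ab i by (simp add: frame)
  qed
  show "Q s'" if frame: "\<And>x. x \<noteq> ''i'' \<Longrightarrow> x \<noteq> ''cur'' \<Longrightarrow> s' x = s x"
    and cur: "\<And>k. k \<in> {1..n} \<Longrightarrow> s' ''cur'' (int ((us ! e') ((us ! e) k))) = int k" for s'
  proof (rule exit)
    let ?h = "us ! e' \<circ> us ! e"
    have h: "?h \<in> \<Gamma>" using comp_in u by simp
    show "perm_in n s' (pinv ?h)"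
      unfolding perm_in_def
    proof
      fix i assume "i \<in> {1..n}"
      then have "pinv ?h i \<in> {1..n}" using in_range pinv_in h by blast
      moreover have "(us ! e') ((us ! e) (pinv ?h i)) = i"
        using permutes_inverses(1)[OF perm[OF h], of i] by simp
      ultimately show "s' ''cur'' (int i) = int (pinv ?h i)" using cur by metis
    qed
  qed (use frame in simp)
qed (use st in \<open>simp_all add: stored_def loop_time_def\<close>)

lemma runs_store:
  assumes st: "stored us U s" and g: "g \<in> \<Gamma>" "perm_in n s g"
    and k: "k < n" "s ''row'' 0 = int n * int k" and j: "j \<in> {1..n}" "s ''j'' 0 = int j"
    and exit: "\<And>s'. (\<And>x. x \<notin> {''i'', ''D'', ''gens'', ''top''} \<Longrightarrow> s' x = s x) \<Longrightarrow>
      stored (us @ [pinv g]) (U(k := (U k)(j := length us))) s' \<Longrightarrow> Q s'"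
  shows "runs store_cmd s (loop_time n + 20) Q"
  unfolding store_cmd_def
proof (rule runs_Seq[where ?t1.0 = 8 and ?t2.0 = "loop_time n + 7"], rule runs_Assign)
  let ?s = "s(''D'' := (s ''D'')(aval (Plus (var ''row'') (var ''j'')) s := aval (var ''top'') s))"
  let ?p = "\<lambda>i. int n * int (length us) + int (g i)"
  show "runs (Seq (For ''i'' (Assign ''gens'' (Plus (var ''top'') (Read ''cur'' (var ''i''))) (var ''i'')))
          (set_var ''top'' (Plus (var ''top'') (var ''nn'')))) ?s (loop_time n + 7) Q"
  proof (rule runs_Seq[where ?t1.0 = "loop_time n" and ?t2.0 = 7],
      rule runs_scatter[where n = n and w = int and p = ?p])
    show "inj_on ?p {1..n}"
      using inj_on_perm[OF g(1), of "{1..n}"] unfolding inj_on_def add_left_cancel of_nat_eq_iff .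
    show "aval (Plus (var ''top'') (Read ''cur'' (var ''i''))) s' = ?p i \<and> aval (var ''i'') s' = int i"
      if "i \<in> {1..n}" "\<And>x. x \<noteq> ''i'' \<Longrightarrow> x \<noteq> ''gens'' \<Longrightarrow> s' x = ?s x" "s' ''i'' 0 = int i" for i s'
    proof -
      have "s ''cur'' (int i) = int (g i)" using g(2) that(1) by (simp add: perm_in_def)
      then show ?thesis using that(3) st by (simp add: that(2) stored_def)
    qed
    show "runs (set_var ''top'' (Plus (var ''top'') (var ''nn''))) s' 7 Q"
      if frame: "\<And>x. x \<noteq> ''i'' \<Longrightarrow> x \<noteq> ''gens'' \<Longrightarrow> s' x = ?s x"
        and new: "\<And>i. i \<in> {1..n} \<Longrightarrow> s' ''gens'' (?p i) = int i"
        and old: "\<And>z. z \<notin> ?p ` {1..n} \<Longrightarrow> s' ''gens'' z = ?s ''gens'' z" for s'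
    proof (rule runs_Assign, rule exit)
      let ?s' = "s'(''top'' := (s' ''top'')(aval (Const 0) s' := aval (Plus (var ''top'') (var ''nn'')) s'))"
      show "?s' x = s x" if "x \<notin> {''i'', ''D'', ''gens'', ''top''}" for x
        using that by (simp add: frame)
      have gens_new: "s' ''gens'' (int n * int (length us) + int i) = int (pinv g i)"
        if "i \<in> {1..n}" for i
        using new[OF in_range[OF pinv_in[OF g(1)] that]] permutes_inverses(1)[OF perm[OF g(1)]] by simp
      have gens_old: "s' ''gens'' (int n * int e + int i) = s ''gens'' (int n * int e + int i)"
        if "i \<in> {1..n}" "e < length us" for e i
      proof -
        have "int n * int e + int i \<notin> ?p ` {1..n}"
          using block_inj[OF that(1) in_range[OF g(1)]] that(2) by blast
        then show ?thesis by (simp add: old)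
      qed
      have D: "s' ''D'' (int n * int k' + int j') =
          int n * int ((U(k := (U k)(j := length us))) k' j')" if "k' < n" "j' \<in> {1..n}" for k' j'
      proof (cases "k' = k \<and> j' = j")
        case True
        then show ?thesis using k j st by (simp add: frame stored_def)
      next
        case False
        then have "int n * int k' + int j' \<noteq> int n * int k + int j"
          using block_inj[OF that(2) j(1)] by blast
        moreover have "(U(k := (U k)(j := length us))) k' j' = U k' j'" using False by auto
        ultimately show ?thesis using k j st that by (simp add: frame stored_def)
      qed
      show "stored (us @ [pinv g]) (U(k := (U k)(j := length us))) ?s'"
        unfolding stored_def
      proof (intro conjI allI impI ballI)
        fix e i assume "e < length (us @ [pinv g])" "i \<in> {1..n}"
        then show "?s' ''gens'' (int n * int e + int i) = int (((us @ [pinv g]) ! e) i)"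
          using gens_old gens_new st by (cases "e = length us") (simp_all add: nth_append stored_def)
      next
        fix k' j' assume "k' < n" "j' \<in> {1..n}"
        from D[OF this]
        show "?s' ''D'' (int n * int k' + int j') = int n * int ((U(k := (U k)(j := length us))) k' j')"
          by simp
      qed (use st in \<open>simp_all add: stored_def frame algebra_simps\<close>)
    qed simp
  qed (use st in \<open>simp_all add: stored_def loop_time_def\<close>)
qed simp_all

lemma runs_apply:
  assumes st: "stored us U s" and g: "g \<in> \<Gamma>" "perm_in n s g"
    and k: "k < n" "s ''row'' 0 = int n * int k" and j: "j \<in> {1..n}" "s ''j'' 0 = int j"
    and e: "U k j < length us"
    and exit: "\<And>s'. (\<And>x. x \<notin> {''i'', ''d'', ''cur''} \<Longrightarrow> s' x = s x) \<Longrightarrow>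
      perm_in n s' (us ! U k j \<circ> g) \<Longrightarrow> Q s'"
  shows "runs apply_cmd s (loop_time n + 10) Q"
  unfolding apply_cmd_def
proof (rule runs_Seq[where ?t1.0 = 10 and ?t2.0 = "loop_time n"], rule runs_Assign)
  let ?s = "s(''d'' := (s ''d'')(aval (Const 0) s := aval (Read ''D'' (Plus (var ''row'') (var ''j''))) s))"
  let ?w = "\<lambda>i. int ((us ! U k j) (g i))"
  show "runs (For ''i'' (Assign ''cur'' (var ''i'') (Read ''gens'' (Plus (var ''d'') (Read ''cur'' (var ''i''))))))
      ?s (loop_time n) Q"
  proof (rule runs_scatter[where n = n and w = ?w and p = int])
    show "aval (var ''i'') s' = int i \<and>
        aval (Read ''gens'' (Plus (var ''d'') (Read ''cur'' (var ''i'')))) s' = ?w i"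
      if i: "i \<in> {1..n}" and frame: "\<And>x. x \<noteq> ''i'' \<Longrightarrow> x \<noteq> ''cur'' \<Longrightarrow> s' x = ?s x"
        and "s' ''i'' 0 = int i" "\<And>z. z \<notin> int ` {1..<i} \<Longrightarrow> s' ''cur'' z = ?s ''cur'' z" for i s'
    proof -
      have "s' ''cur'' (int i) = int (g i)" using that(4)[of "int i"] frame g(2) i by (simp add: perm_in_def image_iff)
      moreover have "s' ''d'' 0 = int n * int (U k j)" using st k j by (simp add: frame stored_def)
      moreover have "s ''gens'' (int n * int (U k j) + int (g i)) = ?w i"
        using st e in_range[OF g(1) i] by (simp add: stored_def)
      ultimately show ?thesis using that(3) by (simp add: frame)
    qed
    show "Q s'" if "\<And>x. x \<noteq> ''i'' \<Longrightarrow> x \<noteq> ''cur'' \<Longrightarrow> s' x = ?s x"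
      "\<And>i. i \<in> {1..n} \<Longrightarrow> s' ''cur'' (int i) = ?w i" for s'
      by (rule exit) (use that in \<open>simp_all add: perm_in_def\<close>)
  qed (use st in \<open>simp_all add: stored_def loop_time_def\<close>)
qed simp_all

abbreviation level_scratch :: "string set" where
  "level_scratch \<equiv> {''row'', ''l'', ''j'', ''d'', ''D'', ''i'', ''cur'', ''gens'', ''top''}"

abbreviation scratch :: "string set" where
  "scratch \<equiv> insert ''k'' level_scratch"

text \<open>
  One level turns \<open>g\<close> into some \<open>g'\<close> that fixes one more leader. The last premise of \<open>exit\<close> says that
  \<open>g\<close> sifts from level \<open>k\<close> on if \<open>g'\<close> does from the next level on. It is stated for all later tables
  because the table may grow at later levels.
\<close>

lemma runs_level:
  assumes st: "stored us U s" and ok: "pool_ok us U"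
    and g: "g \<in> \<Gamma>" "perm_in n s g" "\<And>i. i < k \<Longrightarrow> g (L ! i) = L ! i"
    and k: "k < n" "s ''row'' 0 = int n * int k" "s ''k'' 0 = int k + 1"
    and exit: "\<And>s' us' U' g'. (\<And>x. x \<notin> level_scratch \<Longrightarrow> s' x = s x) \<Longrightarrow>
      stored us' U' s' \<Longrightarrow> pool_ok us' U' \<Longrightarrow> extends us U us' U' \<Longrightarrow>
      g' \<in> \<Gamma> \<Longrightarrow> perm_in n s' g' \<Longrightarrow> (\<And>i. i < Suc k \<Longrightarrow> g' (L ! i) = L ! i) \<Longrightarrow>
      s' ''row'' 0 = int n * int (Suc k) \<Longrightarrow>
      (\<And>us'' U''. extends us' U' us'' U'' \<Longrightarrow>
        sifts L (table us'' U'') (Suc k) g' \<Longrightarrow> sifts L (table us'' U'') k g) \<Longrightarrow> Q s'"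
  shows "runs level_cmd s (level_time n) Q"
proof -
  define j where "j = g (L ! k)"
  have j: "j \<in> {1..n}" using in_range[OF g(1) L_in[OF k(1)]] by (simp add: j_def)
  define s1 where "s1 = s(''l'' := (s ''l'')(0 := int (L ! k)))"
  define s2 where "s2 = s1(''j'' := (s1 ''j'')(0 := int j))"
  define inner where "inner = If (Eq (var ''j'') (var ''l'')) Skip
    (Seq (If (Eq (Read ''D'' (Plus (var ''row'') (var ''j''))) (Const 0)) store_cmd Skip) apply_cmd)"
  define R where "R s' \<longleftrightarrow> (\<exists>us' U' g'. (\<forall>x. x \<notin> level_scratch \<longrightarrow> s' x = s x) \<and>
      stored us' U' s' \<and> pool_ok us' U' \<and> extends us U us' U' \<and>
      g' \<in> \<Gamma> \<and> perm_in n s' g' \<and> (\<forall>i<Suc k. g' (L ! i) = L ! i) \<and>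
      s' ''row'' 0 = int n * int k \<and>
      (\<forall>us'' U''. extends us' U' us'' U'' \<longrightarrow>
        sifts L (table us'' U'') (Suc k) g' \<longrightarrow> sifts L (table us'' U'') k g))" for s'
  have st2: "stored us U s2" by (rule stored_cong[OF st]) (auto simp: s1_def s2_def)
  have cur2: "perm_in n s2 g" using g(2) by (simp add: perm_in_def s1_def s2_def)
  have s2: "s2 ''row'' 0 = int n * int k" "s2 ''j'' 0 = int j" "s2 ''l'' 0 = int (L ! k)"
    "\<And>x. x \<notin> level_scratch \<Longrightarrow> s2 x = s x"
    using k by (auto simp: s1_def s2_def)
  have D2: "s2 ''D'' (int n * int k + int j) = int n * int (U k j)"
    using st2 k(1) j by (simp add: stored_def)
  have inner: "runs inner s2 (2 * loop_time n + 70) R"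
    unfolding inner_def
  proof (rule runs_If[where ?t1.0 = "2 * loop_time n + 55"])
    assume "bval (Eq (var ''j'') (var ''l'')) s2"
    then have "g (L ! k) = L ! k" using s2 by (simp add: j_def)
    then have "g (L ! i) = L ! i" if "i < Suc k" for i
      using g(3) that by (cases "i = k") simp_all
    moreover have "sifts L W k g" if "sifts L W (Suc k) g" for W
      using \<open>g (L ! k) = L ! k\<close> that by (rule sifts_skip)
    ultimately have "R s2"
      unfolding R_def using st2 ok extends_refl[of us U] g(1) cur2 s2(1,4)
      by (intro exI[of _ us] exI[of _ U] exI[of _ g] conjI allI impI)
    then show "runs Skip s2 (2 * loop_time n + 55) R" by (rule runs_Skip) simp
  next
    assume "\<not> bval (Eq (var ''j'') (var ''l'')) s2"
    then have ne: "g (L ! k) \<noteq> L ! k" using s2 by (simp add: j_def)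
    define S where "S s' us' U' \<longleftrightarrow> (\<forall>x. x \<notin> {''i'', ''D'', ''gens'', ''top''} \<longrightarrow> s' x = s2 x) \<and>
        stored us' U' s' \<and> pool_ok us' U' \<and> extends us U us' U' \<and> U' k j \<noteq> 0" for s' us' U'
    have fill: "runs (If (Eq (Read ''D'' (Plus (var ''row'') (var ''j''))) (Const 0)) store_cmd Skip) s2
        (loop_time n + 45) (\<lambda>s'. \<exists>us' U'. S s' us' U')"
    proof (rule runs_If[where ?t1.0 = "loop_time n + 20"])
      assume "bval (Eq (Read ''D'' (Plus (var ''row'') (var ''j''))) (Const 0)) s2"
      then have U0: "U k j = 0" using s2 D2 n_pos by simp
      let ?us = "us @ [pinv g]" and ?U = "U(k := (U k)(j := length us))"
      have ok': "pool_ok ?us ?U"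
        using pool_ok_insert[OF ok g(1) k(1) g(3) ne] U0 by (simp add: j_def)
      have "extends us U ?us ?U" using U0 by (auto simp: extends_def)
      moreover have "?U k j \<noteq> 0" using ok by (simp add: pool_ok_def)
      ultimately have "S s' ?us ?U" if "\<And>x. x \<notin> {''i'', ''D'', ''gens'', ''top''} \<Longrightarrow> s' x = s2 x"
        "stored ?us ?U s'" for s'
        using ok' that unfolding S_def by blast
      then show "runs store_cmd s2 (loop_time n + 20) (\<lambda>s'. \<exists>us' U'. S s' us' U')"
        by (intro runs_store[OF st2 g(1) cur2 k(1) s2(1) j s2(2)]) blast
    next
      assume "\<not> bval (Eq (Read ''D'' (Plus (var ''row'') (var ''j''))) (Const 0)) s2"
      then have "U k j \<noteq> 0" using s2 D2 by auto
      then have "S s2 us U" using st2 ok extends_refl by (simp add: S_def)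
      then show "runs Skip s2 (loop_time n + 20) (\<lambda>s'. \<exists>us' U'. S s' us' U')"
        by (intro runs_Skip) auto
    qed simp
    have "runs apply_cmd s' (loop_time n + 10) R" if "S s' us' U'" for s' us' U'
    proof -
      have S: "\<And>x. x \<notin> {''i'', ''D'', ''gens'', ''top''} \<Longrightarrow> s' x = s2 x" "stored us' U' s'"
        "pool_ok us' U'" "extends us U us' U'" "U' k j \<noteq> 0" using that by (auto simp: S_def)
      let ?u = "us' ! U' k j"
      note u = table_entry[OF S(3,5)]
      have cur': "perm_in n s' g" using cur2 by (simp add: perm_in_def S(1))
      show ?thesis
      proof (rule runs_apply[OF S(2) g(1) cur' k(1) _ j])
        fix s3 assume frame: "\<And>x. x \<notin> {''i'', ''d'', ''cur''} \<Longrightarrow> s3 x = s' x"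
          and cur3: "perm_in n s3 (?u \<circ> g)"
        have "stored us' U' s3" by (rule stored_cong[OF S(2)]) (auto simp: frame)
        moreover have "?u \<circ> g \<in> \<Gamma>" using comp_in g u by simp
        moreover have "(?u \<circ> g) (L ! i) = L ! i" if "i < Suc k" for i
          using u g(3) that by (auto simp: less_Suc_eq j_def)
        moreover have "sifts L (table us'' U'') k g"
          if "extends us' U' us'' U''" "sifts L (table us'' U'') (Suc k) (?u \<circ> g)" for us'' U''
        proof -
          have "table us' U' k j = Some ?u" using S(5) by (simp add: table_def)
          then have "table us'' U'' k (g (L ! k)) = Some ?u"
            using extends_table[OF that(1) S(3)] by (simp add: j_def)
          then show ?thesis using that(2) by (rule sifts_strip)
        qed
        moreover have "s3 x = s x" if "x \<notin> level_scratch" for x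
          using that by (simp add: frame S(1) s2(4))
        moreover have "s3 ''row'' 0 = int n * int k" by (simp add: frame S(1) s2(1))
        ultimately show "R s3"
          unfolding R_def using S(3,4) cur3
          by (intro exI[of _ us'] exI[of _ U'] exI[of _ "?u \<circ> g"] conjI allI impI)
      qed (use u S(1) s2 in simp_all)
    qed
    then show "runs (Seq (If (Eq (Read ''D'' (Plus (var ''row'') (var ''j''))) (Const 0)) store_cmd Skip)
        apply_cmd) s2 (2 * loop_time n + 55) R"
      by (intro runs_Seq[OF runs_mono[OF fill le_refl]]) auto
  qed simp
  have finish: "runs (set_var ''row'' (Plus (var ''row'') (var ''nn''))) s' 7 Q" if "R s'" for s'
  proof (rule runs_Assign)
    let ?s = "s'(''row'' := (s' ''row'')(aval (Const 0) s' := aval (Plus (var ''row'') (var ''nn'')) s'))"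
    obtain us' U' g' where "\<forall>x. x \<notin> level_scratch \<longrightarrow> s' x = s x"
      "stored us' U' s'" "pool_ok us' U'" "extends us U us' U'"
      "g' \<in> \<Gamma>" "perm_in n s' g'" "\<forall>i<Suc k. g' (L ! i) = L ! i"
      "s' ''row'' 0 = int n * int k"
      "\<forall>us'' U''. extends us' U' us'' U'' \<longrightarrow>
        sifts L (table us'' U'') (Suc k) g' \<longrightarrow> sifts L (table us'' U'') k g"
      using \<open>R s'\<close> unfolding R_def by (elim exE conjE)
    note R = this[rule_format]
    have st': "stored us' U' ?s" by (rule stored_cong[OF R(2)]) auto
    have cur': "perm_in n ?s g'" using R(6) by (simp add: perm_in_def)
    show "Q ?s"
    proof (rule exit[OF _ st' R(3,4,5) cur' R(7) _ R(9)])
      show "?s x = s x" if "x \<notin> level_scratch" for x using that by (simp add: R(1))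
      show "?s ''row'' 0 = int n * int (Suc k)" using R(2,8) by (simp add: stored_def algebra_simps)
    qed
  qed simp
  have l: "s ''leaders'' (1 + int k) = int (L ! k)" using st k(1) by (simp add: stored_def add.commute)
  have c: "s ''cur'' (int (L ! k)) = int j"
    using g(2) L_in[OF k(1)] by (simp add: perm_in_def j_def)
  have "runs (Seq inner (set_var ''row'' (Plus (var ''row'') (var ''nn'')))) s2 (2 * loop_time n + 77) Q"
    by (rule runs_Seq[OF runs_mono[OF inner le_refl finish]]) auto
  then have "runs (Seq (set_var ''j'' (Read ''cur'' (var ''l''))) 
      (Seq inner (set_var ''row'' (Plus (var ''row'') (var ''nn''))))) s1 (2 * loop_time n + 90) Q"
    by - (rule runs_Assign_Seq[where ?t1.0 = "2 * loop_time n + 77"], simp_all add: s1_def c s2_def)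
  then show ?thesis
    unfolding level_cmd_def level_time_def inner_def[symmetric]
    by - (rule runs_Assign_Seq[where ?t1.0 = "2 * loop_time n + 90"],
      simp_all add: s1_def l k(3) add.commute)
qed

lemma runs_sift:
  assumes st: "stored us U s" and ok: "pool_ok us U" and g: "g \<in> \<Gamma>" "perm_in n s g"
    and exit: "\<And>s' us' U'. (\<And>x. x \<notin> scratch \<Longrightarrow> s' x = s x) \<Longrightarrow> stored us' U' s' \<Longrightarrow>
      pool_ok us' U' \<Longrightarrow> extends us U us' U' \<Longrightarrow> sifts L (table us' U') 0 g \<Longrightarrow> Q s'"
  shows "runs sift_cmd s (sift_time n) Q"
proof -
  define I where "I k s' \<longleftrightarrow> (\<exists>us' U' h. (\<forall>x. x \<notin> scratch \<longrightarrow> s' x = s x) \<and>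
      stored us' U' s' \<and> pool_ok us' U' \<and> extends us U us' U' \<and>
      h \<in> \<Gamma> \<and> perm_in n s' h \<and> (\<forall>i<k. h (L ! i) = L ! i) \<and> s' ''row'' 0 = int n * int k \<and>
      (\<forall>us'' U''. extends us' U' us'' U'' \<longrightarrow>
        sifts L (table us'' U'') k h \<longrightarrow> sifts L (table us'' U'') 0 g))" for k s'
  show ?thesis
    unfolding sift_cmd_def sift_time_def
  proof (rule runs_Seq[where ?t1.0 = 3 and ?t2.0 = "n * (level_time n + 13) + 10"], rule runs_Assign,
      rule runs_For[where I = I and n = n and tc = "level_time n"])
    let ?s = "s(''row'' := (s ''row'')(aval (Const 0) s := aval (Const 0) s))"
    let ?s' = "?s(''k'' := (?s ''k'')(0 := 1))"
    have "stored us U ?s'" by (rule stored_cong[OF st]) auto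
    moreover have "perm_in n ?s' g" using g(2) by (simp add: perm_in_def)
    ultimately show "I 0 ?s'"
      unfolding I_def using ok g(1) extends_refl
      by (intro exI[of _ us] exI[of _ U] exI[of _ g]) auto
  next
    fix k s' assume k: "k < n" "s' ''k'' 0 = int k + 1" and "I k s'"
    then obtain us' U' h where "\<forall>x. x \<notin> scratch \<longrightarrow> s' x = s x"
      "stored us' U' s'" "pool_ok us' U'" "extends us U us' U'"
      "h \<in> \<Gamma>" "perm_in n s' h" "\<forall>i<k. h (L ! i) = L ! i" "s' ''row'' 0 = int n * int k"
      "\<forall>us'' U''. extends us' U' us'' U'' \<longrightarrow>
        sifts L (table us'' U'') k h \<longrightarrow> sifts L (table us'' U'') 0 g"
      unfolding I_def by (elim exE conjE)
    note I = this[rule_format]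
    show "runs level_cmd s' (level_time n) (\<lambda>s'. s' ''k'' 0 = int k + 1 \<and> s' ''nn'' 0 = int n \<and>
        I (Suc k) (s'(''k'' := (s' ''k'')(0 := 2 + int k))))"
    proof (rule runs_level[OF I(2,3,5,6,7) k(1) I(8) k(2)])
      fix s2 us2 U2 h2
      assume frame: "\<And>x. x \<notin> level_scratch \<Longrightarrow> s2 x = s' x"
        and st2: "stored us2 U2 s2" and ok2: "pool_ok us2 U2" and ext2: "extends us' U' us2 U2"
        and h2: "h2 \<in> \<Gamma>" "perm_in n s2 h2" "\<And>i. i < Suc k \<Longrightarrow> h2 (L ! i) = L ! i"
        and row: "s2 ''row'' 0 = int n * int (Suc k)"
        and sift: "\<And>us'' U''. extends us2 U2 us'' U'' \<Longrightarrow>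
          sifts L (table us'' U'') (Suc k) h2 \<Longrightarrow> sifts L (table us'' U'') k h"
      let ?s = "s2(''k'' := (s2 ''k'')(0 := 2 + int k))"
      have "stored us2 U2 ?s" by (rule stored_cong[OF st2]) auto
      moreover have "perm_in n ?s h2" using h2(2) by (simp add: perm_in_def)
      moreover have "?s x = s x" if "x \<notin> scratch" for x
        using that by (simp add: frame I(1))
      moreover have "?s ''row'' 0 = int n * int (Suc k)" using row by simp
      moreover have "sifts L (table us'' U'') 0 g"
        if "extends us2 U2 us'' U''" "sifts L (table us'' U'') (Suc k) h2" for us'' U''
        using I(9)[OF extends_trans[OF ext2 that(1)] sift[OF that]] .
      ultimately have "I (Suc k) ?s"
        unfolding I_def using ok2 h2 extends_trans[OF I(4) ext2]
        by (intro exI[of _ us2] exI[of _ U2] exI[of _ h2] conjI allI impI)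
      moreover have "s2 ''k'' 0 = int k + 1" using k(2) by (simp add: frame)
      moreover have "s2 ''nn'' 0 = int n" using st2 by (simp add: stored_def)
      ultimately show "s2 ''k'' 0 = int k + 1 \<and> s2 ''nn'' 0 = int n \<and> I (Suc k) ?s" by simp
    qed
  next
    fix s' assume "I n s'"
    then obtain us' U' h where "\<forall>x. x \<notin> scratch \<longrightarrow> s' x = s x"
      "stored us' U' s'" "pool_ok us' U'" "extends us U us' U'"
      "h \<in> \<Gamma>" "\<forall>i<n. h (L ! i) = L ! i"
      "\<forall>us'' U''. extends us' U' us'' U'' \<longrightarrow>
        sifts L (table us'' U'') n h \<longrightarrow> sifts L (table us'' U'') 0 g"
      unfolding I_def by (elim exE conjE)
    note I = this[rule_format]
    have "h = id" using fix_all I(5,6) by blast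
    then have "sifts L (table us' U') n h" using sifts_id[of L] length_L by metis
    then have "sifts L (table us' U') 0 g" using I(7) extends_refl by simp
    then show "Q s'" using exit[OF I(1-4)] by simp
  qed (use st in \<open>simp_all add: stored_def\<close>)
qed

end

section \<open>Closing the pool and moving the solution\<close>

definition pair_cmd :: "string \<Rightarrow> string \<Rightarrow> com" where
  "pair_cmd a b = Seq (inv_prod_cmd a b) sift_cmd"

text \<open>
  Sift the pairs \<open>(a, b)\<close> and \<open>(b, a)\<close> for all blocks \<open>b \<le> a\<close>. As the pool grows during the loop, it
  matters that the inner loop ends at \<open>a\<close>: new blocks are paired with all the others once the
  outer loop has reached them.
\<close>

definition closure_cmd :: com where
  "closure_cmd = Seq (set_var ''a'' (Const 0)) (While (Less (var ''a'') (var ''top''))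
     (Seq (set_var ''b'' (Const 0))
     (Seq (While (Neg (Less (var ''a'') (var ''b'')))
             (Seq (pair_cmd ''a'' ''b'') (Seq (pair_cmd ''b'' ''a'')
               (set_var ''b'' (Plus (var ''b'') (var ''nn''))))))
          (set_var ''a'' (Plus (var ''a'') (var ''nn''))))))"

text \<open>
  Set \<open>top\<close> to \<open>n\<close> times the number of generators by repeated addition, and append the identity.
\<close>

definition init_cmd :: com where
  "init_cmd = Seq (set_var ''c'' (var ''gens_count''))
     (Seq (While (Less (Const 0) (var ''c''))
             (Seq (set_var ''top'' (Plus (var ''top'') (var ''nn'')))
                  (set_var ''c'' (Minus (var ''c'') (Const 1)))))
     (Seq (For ''i'' (Assign ''gens'' (Plus (var ''top'') (var ''i'')) (var ''i'')))
          (set_var ''top'' (Plus (var ''top'') (var ''nn'')))))"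

text \<open>
  Find a position with the largest value of \<open>x\<close> among the filled entries of the current row and the
  leader, with which \<open>best\<close> is initialized.
\<close>

definition best_cmd :: com where
  "best_cmd = For ''j'' (If (Conj (Neg (Eq (Read ''D'' (Plus (var ''row'') (var ''j''))) (Const 0)))
                                 (Less (Read ''x'' (var ''best'')) (Read ''x'' (var ''j''))))
                           (set_var ''best'' (var ''j'')) Skip)"

text \<open>
  Apply the table entry for position \<open>best\<close> to the vector \<open>x\<close>.
\<close>

definition move_cmd :: com where
  "move_cmd = Seq (set_var ''d'' (Read ''D'' (Plus (var ''row'') (var ''best''))))
     (Seq (For ''i'' (Assign ''y'' (Read ''gens'' (Plus (var ''d'') (var ''i''))) (Read ''x'' (var ''i''))))
          (For ''i'' (Assign ''x'' (var ''i'') (Read ''y'' (var ''i'')))))"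

text \<open>
  Make the cuts of one more leader hold. No move is needed if the leader itself has the largest value.
\<close>

definition greedy_level_cmd :: com where
  "greedy_level_cmd = Seq (set_var ''l'' (Read ''leaders'' (var ''k'')))
     (Seq (set_var ''best'' (var ''l''))
     (Seq best_cmd
     (Seq (If (Eq (var ''best'') (var ''l'')) Skip move_cmd)
          (set_var ''row'' (Plus (var ''row'') (var ''nn''))))))"

definition greedy_cmd :: com where
  "greedy_cmd = Seq (set_var ''row'' (Const 0)) (For ''k'' greedy_level_cmd)"

text \<open>
  In the following bounds \<open>N\<close> is an upper bound on the size of the pool and \<open>M\<close> the number of generators.
\<close>

definition pair_time :: "nat \<Rightarrow> nat" where "pair_time n = loop_time n + sift_time n"

definition inner_time :: "nat \<Rightarrow> nat \<Rightarrow> nat" where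
  "inner_time n N = N * (2 * pair_time n + 14) + 7"

definition closure_time :: "nat \<Rightarrow> nat \<Rightarrow> nat" where
  "closure_time n N = N * (inner_time n N + 16) + 9"

definition init_time :: "nat \<Rightarrow> nat \<Rightarrow> nat" where
  "init_time n M = 18 * M + loop_time n + 16"

definition best_time :: "nat \<Rightarrow> nat" where "best_time n = 46 * n + 10"

definition greedy_level_time :: "nat \<Rightarrow> nat" where
  "greedy_level_time n = best_time n + 2 * loop_time n + 60"

definition greedy_time :: "nat \<Rightarrow> nat" where
  "greedy_time n = n * (greedy_level_time n + 13) + 13"

context sst_run
begin

text \<open>
  The inverse of the product of two pool members, as computed by \<open>inv_prod_cmd\<close>, sifts.
\<close>

definition pair_sifts :: "(nat \<Rightarrow> nat) list \<Rightarrow> (nat \<Rightarrow> nat \<Rightarrow> nat) \<Rightarrow> nat \<Rightarrow> nat \<Rightarrow> bool" where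
  "pair_sifts us U e e' \<longleftrightarrow> sifts L (table us U) 0 (pinv (us ! e' \<circ> us ! e))"

lemma pair_sifts_extends:
  assumes "extends us U us' U'" "pool_ok us U" "pair_sifts us U e e'" "e < length us" "e' < length us"
  shows "pair_sifts us' U' e e'"
  using assms sifts_extends extends_nth unfolding pair_sifts_def by metis

lemma runs_pair:
  assumes st: "stored us U s" and ok: "pool_ok us U" and e: "e < length us" "e' < length us"
    and ab: "s a 0 = int n * int e" "s b 0 = int n * int e'" "a \<notin> {''i'', ''cur''}" "b \<notin> {''i'', ''cur''}"
    and exit: "\<And>s' us' U'. (\<And>x. x \<notin> scratch \<Longrightarrow> s' x = s x) \<Longrightarrow> stored us' U' s' \<Longrightarrow>
      pool_ok us' U' \<Longrightarrow> extends us U us' U' \<Longrightarrow> pair_sifts us' U' e e' \<Longrightarrow> Q s'"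
  shows "runs (pair_cmd a b) s (pair_time n) Q"
  unfolding pair_cmd_def pair_time_def
proof (rule runs_Seq[OF runs_inv_prod[OF st ok e ab] le_refl])
  fix s' assume frame: "\<And>x. x \<notin> {''i'', ''cur''} \<Longrightarrow> s' x = s x"
    and cur: "perm_in n s' (pinv (us ! e' \<circ> us ! e))"
  have "us ! e \<in> \<Gamma>" "us ! e' \<in> \<Gamma>" using ok e by (auto simp: pool_ok_def)
  then have g: "pinv (us ! e' \<circ> us ! e) \<in> \<Gamma>" using pinv_in comp_in by blast
  have st': "stored us U s'" by (rule stored_cong[OF st]) (auto simp: frame)
  show "runs sift_cmd s' (sift_time n) Q"
  proof (rule runs_sift[OF st' ok g cur])
    fix s2 us2 U2 assume frame2: "\<And>x. x \<notin> scratch \<Longrightarrow> s2 x = s' x"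
      and *: "stored us2 U2 s2" "pool_ok us2 U2" "extends us U us2 U2"
      and sifts: "sifts L (table us2 U2) 0 (pinv (us ! e' \<circ> us ! e))"
    have "pair_sifts us2 U2 e e'"
      using sifts extends_nth[OF *(3)] e unfolding pair_sifts_def by metis
    then show "Q s2" by (intro exit[OF _ *]) (auto simp: frame frame2)
  qed
qed

lemma runs_closure_inner:
  assumes st: "stored us U s" and ok: "pool_ok us U"
    and a: "a < length us" "s ''a'' 0 = int n * int a" and b: "s ''b'' 0 = 0"
    and N: "a < N"
    and exit: "\<And>s' us' U'. (\<And>x. x \<notin> insert ''b'' scratch \<Longrightarrow> s' x = s x) \<Longrightarrow> stored us' U' s' \<Longrightarrow>
      pool_ok us' U' \<Longrightarrow> extends us U us' U' \<Longrightarrow>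
      (\<And>e. e \<le> a \<Longrightarrow> pair_sifts us' U' a e \<and> pair_sifts us' U' e a) \<Longrightarrow> Q s'"
  shows "runs (While (Neg (Less (var ''a'') (var ''b'')))
     (Seq (pair_cmd ''a'' ''b'') (Seq (pair_cmd ''b'' ''a'')
       (set_var ''b'' (Plus (var ''b'') (var ''nn'')))))) s (inner_time n N) Q"
proof -
  define I where "I m s' \<longleftrightarrow> (\<exists>us' U' b. (\<forall>x. x \<notin> insert ''b'' scratch \<longrightarrow> s' x = s x) \<and>
     stored us' U' s' \<and> pool_ok us' U' \<and> extends us U us' U' \<and> b \<le> Suc a \<and> m = Suc a - b \<and>
     s' ''b'' 0 = int n * int b \<and> (\<forall>e<b. pair_sifts us' U' a e \<and> pair_sifts us' U' e a))" for m s'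
  show ?thesis
  proof (rule runs_While[where I = I and m = "Suc a" and tc = "2 * pair_time n + 7"])
    show "I (Suc a) s" unfolding I_def
      using st ok extends_refl b by (intro exI[of _ us] exI[of _ U] exI[of _ 0]) auto
  next
    fix m s' assume "I m s'" and guard: "bval (Neg (Less (var ''a'') (var ''b''))) s'"
    then obtain us' U' b where "\<forall>x. x \<notin> insert ''b'' scratch \<longrightarrow> s' x = s x"
      "stored us' U' s'" "pool_ok us' U'" "extends us U us' U'" "b \<le> Suc a" "m = Suc a - b"
      "s' ''b'' 0 = int n * int b" "\<forall>e<b. pair_sifts us' U' a e \<and> pair_sifts us' U' e a"
      unfolding I_def by (elim exE conjE)
    note I = this[rule_format]
    have sa: "s' ''a'' 0 = int n * int a" using a by (simp add: I(1))
    then have "b \<le> a" using guard I(7) n_pos by simp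
    then have ab: "a < length us'" "b < length us'" using a(1) extends_length[OF I(4)] by auto
    have "runs (Seq (pair_cmd ''a'' ''b'') (Seq (pair_cmd ''b'' ''a'')
       (set_var ''b'' (Plus (var ''b'') (var ''nn''))))) s' (2 * pair_time n + 7) (I (m - 1))"
    proof (rule runs_Seq[where ?t1.0 = "pair_time n" and ?t2.0 = "pair_time n + 7"],
        rule runs_pair[OF I(2,3) ab sa I(7)])
      fix s1 us1 U1 assume frame1: "\<And>x. x \<notin> scratch \<Longrightarrow> s1 x = s' x"
        and 1: "stored us1 U1 s1" "pool_ok us1 U1" "extends us' U' us1 U1" "pair_sifts us1 U1 a b"
      have ab1: "a < length us1" "b < length us1" using ab extends_length[OF 1(3)] by auto
      have s1: "s1 ''b'' 0 = int n * int b" "s1 ''a'' 0 = int n * int a"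
        using sa I(7) by (simp_all add: frame1)
      show "runs (Seq (pair_cmd ''b'' ''a'') (set_var ''b'' (Plus (var ''b'') (var ''nn'')))) s1
          (pair_time n + 7) (I (m - 1))"
      proof (rule runs_Seq[where ?t1.0 = "pair_time n" and ?t2.0 = 7],
          rule runs_pair[OF 1(1,2) ab1(2,1) s1])
        fix s2 us2 U2 assume frame2: "\<And>x. x \<notin> scratch \<Longrightarrow> s2 x = s1 x"
          and 2: "stored us2 U2 s2" "pool_ok us2 U2" "extends us1 U1 us2 U2" "pair_sifts us2 U2 b a"
        show "runs (set_var ''b'' (Plus (var ''b'') (var ''nn''))) s2 7 (I (m - 1))"
        proof (rule runs_Assign)
          let ?s = "s2(''b'' := (s2 ''b'')(aval (Const 0) s2 := aval (Plus (var ''b'') (var ''nn'')) s2))"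
          have ext: "extends us' U' us2 U2" using extends_trans[OF 1(3) 2(3)] .
          have cl: "pair_sifts us2 U2 a e \<and> pair_sifts us2 U2 e a" if "e < Suc b" for e
          proof (cases "e = b")
            case True
            then show ?thesis using pair_sifts_extends[OF 2(3) 1(2,4) ab1] 2(4) by simp
          next
            case False
            then have "e < b" using that by simp
            then show ?thesis using I(8) pair_sifts_extends[OF ext I(3)] ab by (meson less_trans)
          qed
          have "stored us2 U2 ?s" by (rule stored_cong[OF 2(1)]) auto
          moreover have "?s x = s x" if "x \<notin> insert ''b'' scratch" for x
            using that by (simp add: frame1 frame2 I(1))
          moreover have "?s ''b'' 0 = int n * int (Suc b)"
            using 2(1) s1 by (simp add: frame2 stored_def algebra_simps)
          moreover have "m - 1 = Suc a - Suc b" "Suc b \<le> Suc a" using I(6) \<open>b \<le> a\<close> by auto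
          ultimately show "I (m - 1) ?s"
            unfolding I_def using 2(2) extends_trans[OF I(4) ext] cl[THEN conjunct1] cl[THEN conjunct2]
            by (intro exI[of _ us2] exI[of _ U2] exI[of _ "Suc b"] conjI allI impI)
        qed simp
      qed simp_all
    qed simp_all
    then show "0 < m \<and> runs (Seq (pair_cmd ''a'' ''b'') (Seq (pair_cmd ''b'' ''a'')
       (set_var ''b'' (Plus (var ''b'') (var ''nn''))))) s' (2 * pair_time n + 7) (I (m - 1))"
      using I(6) \<open>b \<le> a\<close> by simp
  next
    fix m s' assume "I m s'" and guard: "\<not> bval (Neg (Less (var ''a'') (var ''b''))) s'"
    then obtain us' U' b where "\<forall>x. x \<notin> insert ''b'' scratch \<longrightarrow> s' x = s x"
      "stored us' U' s'" "pool_ok us' U'" "extends us U us' U'" "b \<le> Suc a"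
      "s' ''b'' 0 = int n * int b" "\<forall>e<b. pair_sifts us' U' a e \<and> pair_sifts us' U' e a"
      unfolding I_def by (elim exE conjE)
    note I = this[rule_format]
    have "s' ''a'' 0 = int n * int a" using a by (simp add: I(1))
    then have "a < b" using guard I(6) n_pos by simp
    then show "Q s'" using exit[OF I(1-4)] I(7) by simp
  next
    have "Suc a * (2 * pair_time n + 14) \<le> N * (2 * pair_time n + 14)"
      using N by (intro mult_le_mono1) simp
    then show "Suc a * (bcost (Neg (Less (var ''a'') (var ''b''))) + 1 + (2 * pair_time n + 7)) +
        bcost (Neg (Less (var ''a'') (var ''b''))) + 1 \<le> inner_time n N"
      by (simp add: inner_time_def algebra_simps)
  qed
qed

lemma runs_closure:
  assumes st: "stored us U s" and ok: "pool_ok us U" and N: "length G + 1 + n * n \<le> N"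
    and exit: "\<And>s' us' U'. (\<And>x. x \<notin> {''a'', ''b''} \<union> scratch \<Longrightarrow> s' x = s x) \<Longrightarrow>
      stored us' U' s' \<Longrightarrow> pool_ok us' U' \<Longrightarrow> extends us U us' U' \<Longrightarrow>
      (\<And>e e'. e < length us' \<Longrightarrow> e' < length us' \<Longrightarrow> pair_sifts us' U' e e') \<Longrightarrow> Q s'"
  shows "runs closure_cmd s (closure_time n N) Q"
proof -
  define I where "I m s' \<longleftrightarrow> (\<exists>us' U' a. (\<forall>x. x \<notin> {''a'', ''b''} \<union> scratch \<longrightarrow> s' x = s x) \<and>
     stored us' U' s' \<and> pool_ok us' U' \<and> extends us U us' U' \<and> a \<le> length us' \<and> m = N - a \<and>
     s' ''a'' 0 = int n * int a \<and> (\<forall>e<a. \<forall>e'<a. pair_sifts us' U' e e'))" for m s'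
  show ?thesis
    unfolding closure_cmd_def
  proof (rule runs_Assign_Seq[where ?t1.0 = "N * (inner_time n N + 16) + 6"],
      rule runs_While[where I = I and m = N and tc = "inner_time n N + 10"])
    let ?s = "s(''a'' := (s ''a'')(aval (Const 0) s := aval (Const 0) s))"
    have "stored us U ?s" by (rule stored_cong[OF st]) auto
    then show "I N ?s" unfolding I_def
      using ok extends_refl by (intro exI[of _ us] exI[of _ U] exI[of _ 0]) auto
  next
    fix m s' assume "I m s'" and guard: "bval (Less (var ''a'') (var ''top'')) s'"
    then obtain us' U' a where "\<forall>x. x \<notin> {''a'', ''b''} \<union> scratch \<longrightarrow> s' x = s x"
      "stored us' U' s'" "pool_ok us' U'" "extends us U us' U'" "a \<le> length us'" "m = N - a"
      "s' ''a'' 0 = int n * int a" "\<forall>e<a. \<forall>e'<a. pair_sifts us' U' e e'"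
      unfolding I_def by (elim exE conjE)
    note I = this[rule_format]
    have "s' ''top'' 0 = int n * int (length us')" using I(2) by (simp add: stored_def)
    then have a: "a < length us'" using guard I(7) n_pos by simp
    then have aN: "a < N" using pool_length[OF I(3)] N by simp
    let ?inner = "While (Neg (Less (var ''a'') (var ''b'')))
             (Seq (pair_cmd ''a'' ''b'') (Seq (pair_cmd ''b'' ''a'')
               (set_var ''b'' (Plus (var ''b'') (var ''nn'')))))"
    let ?s = "s'(''b'' := (s' ''b'')(aval (Const 0) s' := aval (Const 0) s'))"
    have st1: "stored us' U' ?s" by (rule stored_cong[OF I(2)]) auto
    have s1: "?s ''a'' 0 = int n * int a" "?s ''b'' 0 = 0" using I(7) by auto
    have "runs (Seq (set_var ''b'' (Const 0)) (Seq ?inner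
        (set_var ''a'' (Plus (var ''a'') (var ''nn''))))) s' (inner_time n N + 10) (I (m - 1))"
    proof (rule runs_Assign_Seq[where ?t1.0 = "inner_time n N + 7"],
        rule runs_Seq[where ?t1.0 = "inner_time n N" and ?t2.0 = 7],
        rule runs_closure_inner[OF st1 I(3) a s1 aN])
      fix s2 us2 U2 assume frame: "\<And>x. x \<notin> insert ''b'' scratch \<Longrightarrow> s2 x = ?s x"
        and 2: "stored us2 U2 s2" "pool_ok us2 U2" "extends us' U' us2 U2"
          "\<And>e. e \<le> a \<Longrightarrow> pair_sifts us2 U2 a e \<and> pair_sifts us2 U2 e a"
      show "runs (set_var ''a'' (Plus (var ''a'') (var ''nn''))) s2 7 (I (m - 1))"
      proof (rule runs_Assign)
        let ?s' = "s2(''a'' := (s2 ''a'')(aval (Const 0) s2 := aval (Plus (var ''a'') (var ''nn'')) s2))"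
        have "stored us2 U2 ?s'" by (rule stored_cong[OF 2(1)]) auto
        moreover have "?s' x = s x" if "x \<notin> {''a'', ''b''} \<union> scratch" for x
          using that by (simp add: frame I(1))
        moreover have "?s' ''a'' 0 = int n * int (Suc a)"
          using 2(1) I(7) by (simp add: frame stored_def algebra_simps)
        moreover have "pair_sifts us2 U2 e e'" if "e < Suc a" "e' < Suc a" for e e'
        proof (cases "e = a \<or> e' = a")
          case True
          then show ?thesis using 2(4)[of e] 2(4)[of e'] that by auto
        next
          case False
          then have "e < a" "e' < a" using that by auto
          then show ?thesis using pair_sifts_extends[OF 2(3) I(3) I(8)] a by simp
        qed
        moreover have "m - 1 = N - Suc a" using I(6) by simp
        moreover have "Suc a \<le> length us2" using a extends_length[OF 2(3)] by simp
        ultimately show "I (m - 1) ?s'"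
          unfolding I_def using 2(2) extends_trans[OF I(4) 2(3)]
          by (intro exI[of _ us2] exI[of _ U2] exI[of _ "Suc a"] conjI allI impI)
      qed simp
    qed simp_all
    then show "0 < m \<and> runs (Seq (set_var ''b'' (Const 0)) (Seq ?inner
        (set_var ''a'' (Plus (var ''a'') (var ''nn''))))) s' (inner_time n N + 10) (I (m - 1))"
      using I(6) aN by simp
  next
    fix m s' assume "I m s'" and guard: "\<not> bval (Less (var ''a'') (var ''top'')) s'"
    then obtain us' U' a where "\<forall>x. x \<notin> {''a'', ''b''} \<union> scratch \<longrightarrow> s' x = s x"
      "stored us' U' s'" "pool_ok us' U'" "extends us U us' U'" "a \<le> length us'"
      "s' ''a'' 0 = int n * int a" "\<forall>e<a. \<forall>e'<a. pair_sifts us' U' e e'"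
      unfolding I_def by (elim exE conjE)
    note I = this[rule_format]
    have "s' ''top'' 0 = int n * int (length us')" using I(2) by (simp add: stored_def)
    then have "a = length us'" using guard I(5,6) n_pos by simp
    then show "Q s'" using exit[OF I(1-4)] I(7) by simp
  qed (simp_all add: closure_time_def)
qed

lemma pair_sifts_complete:
  assumes ok: "pool_ok us U" and ext: "extends (G @ [id]) U0 us U"
    and pair_sifts: "\<And>e e'. e < length us \<Longrightarrow> e' < length us \<Longrightarrow> pair_sifts us U e e'" and g: "g \<in> \<Gamma>"
  shows "sifts L (table us U) 0 g"
proof (rule sifts_all[OF _ generated, where X = "set us"])
  show "valid_table (table us U)" "set us \<subseteq> \<Gamma>" using ok by (auto simp: pool_ok_def)
  show "id \<in> set us" "set G \<subseteq> set us" using ext by (auto simp: extends_def)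
  show "u \<in> set us" if "table us U k j = Some u" for k j u
  proof -
    have "U k j \<noteq> 0" "u = us ! U k j" using that by (auto simp: table_def split: if_splits)
    then show ?thesis using table_entry[OF ok] by simp
  qed
  show "sifts L (table us U) 0 (pinv (v \<circ> u))" if "u \<in> set us" "v \<in> set us" for u v
    using that pair_sifts unfolding in_set_conv_nth pair_sifts_def by blast
qed (rule g)

lemma pool_ok_init: "pool_ok (G @ [id]) (\<lambda>_ _. 0)"
  using gens id_in by (simp add: pool_ok_def table_def valid_table_def)

lemma runs_init:
  assumes nn: "s ''nn'' 0 = int n" and cnt: "s ''gens_count'' 0 = int (length G)"
    and top: "s ''top'' 0 = 0" and leaders: "\<And>k. k < n \<Longrightarrow> s ''leaders'' (int k + 1) = int (L ! k)"
    and G: "\<And>e i. e < length G \<Longrightarrow> i \<in> {1..n} \<Longrightarrow> s ''gens'' (int n * int e + int i) = int ((G ! e) i)"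
    and D: "s ''D'' = (\<lambda>_. 0)"
    and exit: "\<And>s'. (\<And>x. x \<notin> {''c'', ''top'', ''gens'', ''i''} \<Longrightarrow> s' x = s x) \<Longrightarrow>
      stored (G @ [id]) (\<lambda>_ _. 0) s' \<Longrightarrow> Q s'"
  shows "runs init_cmd s (init_time n (length G)) Q"
  unfolding init_cmd_def
proof (rule runs_Assign_Seq[where ?t1.0 = "18 * length G + loop_time n + 12"],
    rule runs_Seq[where ?t1.0 = "length G * 18 + 5" and ?t2.0 = "loop_time n + 7"])
  let ?s = "s(''c'' := (s ''c'')(aval (Const 0) s := aval (var ''gens_count'') s))"
  define I where "I m s' \<longleftrightarrow> (\<forall>x. x \<notin> {''c'', ''top''} \<longrightarrow> s' x = s x) \<and> m \<le> length G \<and>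
    s' ''c'' 0 = int m \<and> s' ''top'' 0 = int n * int (length G - m)" for m s'
  show "runs (While (Less (Const 0) (var ''c''))
      (Seq (set_var ''top'' (Plus (var ''top'') (var ''nn''))) (set_var ''c'' (Minus (var ''c'') (Const 1)))))
    ?s (length G * 18 + 5) (\<lambda>s1. runs
      (Seq (For ''i'' (Assign ''gens'' (Plus (var ''top'') (var ''i'')) (var ''i'')))
          (set_var ''top'' (Plus (var ''top'') (var ''nn'')))) s1 (loop_time n + 7) Q)"
  proof (rule runs_While[where I = I and m = "length G" and tc = 13])
    show "I (length G) ?s" using cnt top by (simp add: I_def)
  next
    fix m s' assume I: "I m s'" and "bval (Less (Const 0) (var ''c'')) s'"
    then have m: "0 < m" "m \<le> length G" by (auto simp: I_def)
    then obtain m' where m': "m = Suc m'" by (cases m) auto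
    have nn': "s' ''nn'' 0 = int n" using I nn by (simp add: I_def)
    have len: "int (length G - m') = int (length G - m) + 1" using m m' by simp
    have "runs (Seq (set_var ''top'' (Plus (var ''top'') (var ''nn'')))
        (set_var ''c'' (Minus (var ''c'') (Const 1)))) s' 13 (I (m - 1))"
      by (rule runs_Assign_Seq[where ?t1.0 = 6], rule runs_Assign)
        (use I nn' m m' len in \<open>simp_all add: I_def algebra_simps\<close>)
    then show "0 < m \<and> runs (Seq (set_var ''top'' (Plus (var ''top'') (var ''nn'')))
        (set_var ''c'' (Minus (var ''c'') (Const 1)))) s' 13 (I (m - 1))" using m by simp
  next
    fix m s1 assume I: "I m s1" and "\<not> bval (Less (Const 0) (var ''c'')) s1"
    then have m: "m = 0" by (simp add: I_def)
    have frame1: "\<And>x. x \<notin> {''c'', ''top''} \<Longrightarrow> s1 x = s x" using I by (simp add: I_def)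
    have top1: "s1 ''top'' 0 = int n * int (length G)" using I m by (simp add: I_def)
    let ?p = "\<lambda>i. int n * int (length G) + int i"
    show "runs (Seq (For ''i'' (Assign ''gens'' (Plus (var ''top'') (var ''i'')) (var ''i'')))
          (set_var ''top'' (Plus (var ''top'') (var ''nn'')))) s1 (loop_time n + 7) Q"
    proof (rule runs_Seq[where ?t1.0 = "loop_time n" and ?t2.0 = 7],
        rule runs_scatter[where n = n and w = int and p = ?p])
      show "inj_on ?p {1..n}" by (simp add: inj_on_def)
      show "aval (Plus (var ''top'') (var ''i'')) s' = ?p i \<and> aval (var ''i'') s' = int i"
        if "\<And>x. x \<noteq> ''i'' \<Longrightarrow> x \<noteq> ''gens'' \<Longrightarrow> s' x = s1 x" "s' ''i'' 0 = int i" for i s'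
        using that(2) top1 by (simp add: that(1))
      show "runs (set_var ''top'' (Plus (var ''top'') (var ''nn''))) s' 7 Q"
        if frame: "\<And>x. x \<noteq> ''i'' \<Longrightarrow> x \<noteq> ''gens'' \<Longrightarrow> s' x = s1 x"
          and new: "\<And>i. i \<in> {1..n} \<Longrightarrow> s' ''gens'' (?p i) = int i"
          and old: "\<And>z. z \<notin> ?p ` {1..n} \<Longrightarrow> s' ''gens'' z = s1 ''gens'' z" for s'
      proof (rule runs_Assign, rule exit)
        let ?s' = "s'(''top'' := (s' ''top'')(aval (Const 0) s' := aval (Plus (var ''top'') (var ''nn'')) s'))"
        show "?s' x = s x" if "x \<notin> {''c'', ''top'', ''gens'', ''i''}" for x
          using that by (simp add: frame frame1)
        have gens_old: "s' ''gens'' (int n * int e + int i) = int ((G ! e) i)"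
          if "i \<in> {1..n}" "e < length G" for e i
        proof -
          have "int n * int e + int i \<notin> ?p ` {1..n}" using block_inj[OF that(1)] that(2) by blast
          then show ?thesis using G[OF that(2,1)] by (simp add: old frame1)
        qed
        show "stored (G @ [id]) (\<lambda>_ _. 0) ?s'"
          unfolding stored_def
        proof (intro conjI allI impI ballI)
          fix e i assume "e < length (G @ [id])" "i \<in> {1..n}"
          then show "?s' ''gens'' (int n * int e + int i) = int (((G @ [id]) ! e) i)"
            using gens_old new by (cases "e = length G") (simp_all add: nth_append)
        qed (use nn top1 leaders D in \<open>simp_all add: frame frame1 algebra_simps\<close>)
      qed simp
    qed (use nn in \<open>simp_all add: frame1 loop_time_def\<close>)
  qed simp
qed (simp_all add: init_time_def)

lemma runs_best:
  assumes st: "stored us U s" and k: "k < n" "s ''row'' 0 = int n * int k"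
    and best: "s ''best'' 0 = int (L ! k)"
    and exit: "\<And>s' j. (\<And>x. x \<notin> {''best'', ''j''} \<Longrightarrow> s' x = s x) \<Longrightarrow> s' ''best'' 0 = int j \<Longrightarrow>
      j = L ! k \<or> U k j \<noteq> 0 \<Longrightarrow> s ''x'' (int (L ! k)) \<le> s ''x'' (int j) \<Longrightarrow>
      (\<And>j'. j' \<in> {1..n} \<Longrightarrow> U k j' \<noteq> 0 \<Longrightarrow> s ''x'' (int j') \<le> s ''x'' (int j)) \<Longrightarrow> Q s'"
  shows "runs best_cmd s (best_time n) Q"
proof -
  define I where "I m s' \<longleftrightarrow> (\<exists>j. (\<forall>x. x \<notin> {''best'', ''j''} \<longrightarrow> s' x = s x) \<and> s' ''best'' 0 = int j \<and>
    (j = L ! k \<or> U k j \<noteq> 0) \<and> s ''x'' (int (L ! k)) \<le> s ''x'' (int j) \<and>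
    (\<forall>j'\<in>{1..m}. U k j' \<noteq> 0 \<longrightarrow> s ''x'' (int j') \<le> s ''x'' (int j)))" for m s'
  show ?thesis
    unfolding best_cmd_def
  proof (rule runs_For[where I = I and n = n and tc = 33])
    show "I 0 (s(''j'' := (s ''j'')(0 := 1)))"
      unfolding I_def using best by (intro exI[of _ "L ! k"]) auto
  next
    fix m s' assume m: "m < n" and "I m s'" and sj: "s' ''j'' 0 = int m + 1"
    then obtain j where "\<forall>x. x \<notin> {''best'', ''j''} \<longrightarrow> s' x = s x" "s' ''best'' 0 = int j"
      "j = L ! k \<or> U k j \<noteq> 0" "s ''x'' (int (L ! k)) \<le> s ''x'' (int j)"
      "\<forall>j'\<in>{1..m}. U k j' \<noteq> 0 \<longrightarrow> s ''x'' (int j') \<le> s ''x'' (int j)"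
      unfolding I_def by (elim exE conjE)
    note I = this[rule_format]
    have "s ''D'' (int n * int k + int (Suc m)) = int n * int (U k (Suc m))"
      using st k(1) m unfolding stored_def by (metis Suc_leI atLeastAtMost_iff le_numeral_extra(4) One_nat_def Suc_le_mono le0)
    then have D: "s ''D'' (int n * int k + (int m + 1)) = int n * int (U k (Suc m))"
      by (simp add: add.commute)
    let ?g = "Conj (Neg (Eq (Read ''D'' (Plus (var ''row'') (var ''j''))) (Const 0)))
                 (Less (Read ''x'' (var ''best'')) (Read ''x'' (var ''j'')))"
    have g: "bval ?g s' \<longleftrightarrow> U k (Suc m) \<noteq> 0 \<and> s ''x'' (int j) < s ''x'' (int m + 1)"
      using D k(2) sj n_pos by (simp add: I(1,2))
    have nn: "s' ''nn'' 0 = int n" using st by (simp add: I(1) stored_def)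
    have set: "{1..Suc m} = insert (Suc m) {1..m}" by auto
    show "runs (If ?g (set_var ''best'' (var ''j'')) Skip) s' 33 (\<lambda>s'. s' ''j'' 0 = int m + 1 \<and>
        s' ''nn'' 0 = int n \<and> I (Suc m) (s'(''j'' := (s' ''j'')(0 := 2 + int m))))"
    proof (rule runs_If[where ?t1.0 = 4])
      assume "bval ?g s'"
      then have new: "U k (Suc m) \<noteq> 0" "s ''x'' (int j) < s ''x'' (int (Suc m))"
        using g by (simp_all add: add.commute)
      let ?s = "s'(''best'' := (s' ''best'')(aval (Const 0) s' := aval (var ''j'') s'))"
      have "I (Suc m) (?s(''j'' := (?s ''j'')(0 := 2 + int m)))"
        unfolding I_def set
      proof (intro exI[of _ "Suc m"] conjI ballI impI allI)
        show "s ''x'' (int (L ! k)) \<le> s ''x'' (int (Suc m))" using I(4) new by linarith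
        fix j' assume "j' \<in> insert (Suc m) {1..m}" "U k j' \<noteq> 0"
        then show "s ''x'' (int j') \<le> s ''x'' (int (Suc m))"
          using I(5)[of j'] new(2) by force
      qed (use I(1) new sj in simp_all)
      then show "runs (set_var ''best'' (var ''j'')) s' 4 (\<lambda>s'. s' ''j'' 0 = int m + 1 \<and>
        s' ''nn'' 0 = int n \<and> I (Suc m) (s'(''j'' := (s' ''j'')(0 := 2 + int m))))"
        by - (rule runs_Assign, use sj nn in simp_all)
    next
      assume "\<not> bval ?g s'"
      then have new: "U k (Suc m) \<noteq> 0 \<Longrightarrow> s ''x'' (int (Suc m)) \<le> s ''x'' (int j)"
        unfolding g by (simp add: add.commute)
      have "I (Suc m) (s'(''j'' := (s' ''j'')(0 := 2 + int m)))"
        unfolding I_def set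
      proof (intro exI[of _ j] conjI ballI impI allI)
        fix j' assume "j' \<in> insert (Suc m) {1..m}" "U k j' \<noteq> 0"
        then show "s ''x'' (int j') \<le> s ''x'' (int j)" using I(5) new by blast
      qed (use I in simp_all)
      then show "runs Skip s' 4 (\<lambda>s'. s' ''j'' 0 = int m + 1 \<and>
        s' ''nn'' 0 = int n \<and> I (Suc m) (s'(''j'' := (s' ''j'')(0 := 2 + int m))))"
        by - (rule runs_Skip, use sj nn in simp_all)
    qed simp
  next
    fix s' assume "I n s'"
    then obtain j where "\<forall>x. x \<notin> {''best'', ''j''} \<longrightarrow> s' x = s x" "s' ''best'' 0 = int j"
      "j = L ! k \<or> U k j \<noteq> 0" "s ''x'' (int (L ! k)) \<le> s ''x'' (int j)"
      "\<forall>j'\<in>{1..n}. U k j' \<noteq> 0 \<longrightarrow> s ''x'' (int j') \<le> s ''x'' (int j)"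
      unfolding I_def by (elim exE conjE)
    note I = this[rule_format]
    show "Q s'" by (rule exit[OF I])
  qed (use st in \<open>simp_all add: best_time_def stored_def\<close>)
qed

lemma runs_move:
  assumes st: "stored us U s" and ok: "pool_ok us U" and k: "s ''row'' 0 = int n * int k"
    and j: "s ''best'' 0 = int j" "U k j \<noteq> 0"
    and exit: "\<And>s'. (\<And>x. x \<notin> {''d'', ''i'', ''x'', ''y''} \<Longrightarrow> s' x = s x) \<Longrightarrow>
      out_vector n s' = perm_act (us ! U k j) (out_vector n s) \<Longrightarrow> Q s'"
  shows "runs move_cmd s (2 * loop_time n + 8) Q"
  unfolding move_cmd_def
proof (rule runs_Assign_Seq[where ?t1.0 = "2 * loop_time n"],
    rule runs_Seq[where ?t1.0 = "loop_time n" and ?t2.0 = "loop_time n"])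
  let ?s = "s(''d'' := (s ''d'')(aval (Const 0) s := aval (Read ''D'' (Plus (var ''row'') (var ''best''))) s))"
  define u where "u = us ! U k j"
  note entry = table_entry[OF ok j(2), folded u_def]
  then have u: "u \<in> \<Gamma>" by simp
  have d: "?s ''d'' 0 = int n * int (U k j)" using st entry k j by (simp add: stored_def)
  show "runs (For ''i'' (Assign ''y'' (Read ''gens'' (Plus (var ''d'') (var ''i''))) (Read ''x'' (var ''i''))))
      ?s (loop_time n)
      (\<lambda>s1. runs (For ''i'' (Assign ''x'' (var ''i'') (Read ''y'' (var ''i'')))) s1 (loop_time n) Q)"
  proof (rule runs_scatter[where n = n and p = "\<lambda>i. int (u i)" and w = "\<lambda>i. s ''x'' (int i)"])
    show "inj_on (\<lambda>i. int (u i)) {1..n}"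
      using inj_on_perm[OF u, of "{1..n}"] unfolding inj_on_def of_nat_eq_iff .
    show "aval (Read ''gens'' (Plus (var ''d'') (var ''i''))) s' = int (u i) \<and>
        aval (Read ''x'' (var ''i'')) s' = s ''x'' (int i)"
      if "i \<in> {1..n}" and frame: "\<And>x. x \<noteq> ''i'' \<Longrightarrow> x \<noteq> ''y'' \<Longrightarrow> s' x = ?s x"
        and i: "s' ''i'' 0 = int i" for i s'
    proof -
      have "s ''gens'' (int n * int (U k j) + int i) = int (u i)"
        using st entry that(1) by (simp add: stored_def u_def)
      moreover have "s' ''d'' 0 = int n * int (U k j)" using d frame[of "''d''"] by simp
      ultimately show ?thesis using i by (simp add: frame)
    qed
    fix s1 assume frame1: "\<And>x. x \<noteq> ''i'' \<Longrightarrow> x \<noteq> ''y'' \<Longrightarrow> s1 x = ?s x"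
      and y: "\<And>i. i \<in> {1..n} \<Longrightarrow> s1 ''y'' (int (u i)) = s ''x'' (int i)"
    show "runs (For ''i'' (Assign ''x'' (var ''i'') (Read ''y'' (var ''i'')))) s1 (loop_time n) Q"
    proof (rule runs_scatter[where n = n and p = int and w = "\<lambda>i. s1 ''y'' (int i)"])
      show "aval (var ''i'') s' = int i \<and> aval (Read ''y'' (var ''i'')) s' = s1 ''y'' (int i)"
        if "\<And>x. x \<noteq> ''i'' \<Longrightarrow> x \<noteq> ''x'' \<Longrightarrow> s' x = s1 x" "s' ''i'' 0 = int i" for i s'
        using that(2) by (simp add: that(1))
      fix s2 assume frame2: "\<And>x. x \<noteq> ''i'' \<Longrightarrow> x \<noteq> ''x'' \<Longrightarrow> s2 x = s1 x"
        and x: "\<And>i. i \<in> {1..n} \<Longrightarrow> s2 ''x'' (int i) = s1 ''y'' (int i)"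
      show "Q s2"
      proof (rule exit)
        show "s2 x = s x" if "x \<notin> {''d'', ''i'', ''x'', ''y''}" for x
          using that by (simp add: frame1 frame2)
        have "out_vector n s2 i = perm_act u (out_vector n s) i" for i
        proof (cases "i \<in> {1..n}")
          case True
          then have i': "pinv u i \<in> {1..n}" using in_range pinv_in u by blast
          have "s2 ''x'' (int i) = s1 ''y'' (int (u (pinv u i)))"
            using x[OF True] permutes_inverses(1)[OF perm[OF u]] by simp
          also have "\<dots> = s ''x'' (int (pinv u i))" using y[OF i'] .
          finally show ?thesis using True i' unfolding out_vector_def perm_act_def by simp
        next
          case False
          then have "pinv u i = i" using permutes_not_in[OF perm[OF pinv_in[OF u]]] by simp
          then show ?thesis using False by (auto simp: out_vector_def perm_act_def)
        qed
        then show "out_vector n s2 = perm_act (us ! U k j) (out_vector n s)"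
          unfolding u_def by (rule ext)
      qed
    qed (use st in \<open>simp_all add: frame1 stored_def loop_time_def\<close>)
  qed (use st in \<open>simp_all add: stored_def loop_time_def\<close>)
qed simp_all

text \<open>
  \<open>P\<close> is any property of vectors that is invariant under the group.
\<close>

lemma runs_greedy_level:
  assumes st: "stored us U s" and ok: "pool_ok us U"
    and complete: "\<And>g. g \<in> \<Gamma> \<Longrightarrow> sifts L (table us U) 0 g"
    and sym: "\<And>u y. u \<in> \<Gamma> \<Longrightarrow> P y \<Longrightarrow> P (perm_act u y)"
    and x: "P (out_vector n s)" "cuts_hold k (out_vector n s)"
    and k: "k < n" "s ''row'' 0 = int n * int k" "s ''k'' 0 = int k + 1"
    and exit: "\<And>s'. (\<And>x. x \<notin> {''l'', ''best'', ''j'', ''d'', ''i'', ''x'', ''y'', ''row''} \<Longrightarrow> s' x = s x) \<Longrightarrow>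
      s' ''row'' 0 = int n * int (Suc k) \<Longrightarrow> P (out_vector n s') \<Longrightarrow>
      cuts_hold (Suc k) (out_vector n s') \<Longrightarrow> Q s'"
  shows "runs greedy_level_cmd s (greedy_level_time n) Q"
  unfolding greedy_level_cmd_def
proof (rule runs_Assign_Seq[where ?t1.0 = "best_time n + 2 * loop_time n + 50"],
    rule runs_Assign_Seq[where ?t1.0 = "best_time n + 2 * loop_time n + 40"],
    rule runs_Seq[where ?t1.0 = "best_time n" and ?t2.0 = "2 * loop_time n + 40"])
  let ?s = "s(''l'' := (s ''l'')(aval (Const 0) s := aval (Read ''leaders'' (var ''k'')) s))"
  define s1 where "s1 = ?s(''best'' := (?s ''best'')(aval (Const 0) ?s := aval (var ''l'') ?s))"
  have "s ''leaders'' (int k + 1) = int (L ! k)" using st k(1) by (simp add: stored_def)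
  then have s1: "s1 ''l'' 0 = int (L ! k)" "s1 ''best'' 0 = int (L ! k)" "s1 ''row'' 0 = int n * int k"
    "\<And>x. x \<notin> {''l'', ''best''} \<Longrightarrow> s1 x = s x"
    using k by (simp_all add: s1_def)
  have st1: "stored us U s1" by (rule stored_cong[OF st]) (auto simp: s1(4))
  show "runs best_cmd s1 (best_time n) (\<lambda>s2. runs (Seq (If (Eq (var ''best'') (var ''l'')) Skip move_cmd)
          (set_var ''row'' (Plus (var ''row'') (var ''nn'')))) s2 (2 * loop_time n + 40) Q)"
  proof (rule runs_best[OF st1 k(1) s1(3,2)])
    fix s2 j assume frame2: "\<And>x. x \<notin> {''best'', ''j''} \<Longrightarrow> s2 x = s1 x"
      and best: "s2 ''best'' 0 = int j" and j: "j = L ! k \<or> U k j \<noteq> 0"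
      and max0: "s1 ''x'' (int (L ! k)) \<le> s1 ''x'' (int j)"
      and max: "\<And>j'. j' \<in> {1..n} \<Longrightarrow> U k j' \<noteq> 0 \<Longrightarrow> s1 ''x'' (int j') \<le> s1 ''x'' (int j)"
    have st2: "stored us U s2" by (rule stored_cong[OF st1]) (auto simp: frame2)
    have vec2: "out_vector n s2 = out_vector n s" by (simp add: out_vector_def frame2 s1(4))
    have j_in: "j \<in> {1..n}" using j L_in[OF k(1)] table_entry[OF ok] by blast
    have max_orb: "out_vector n s f \<le> out_vector n s j" if "f \<in> orb (L ! k) (level_group k)" for f
    proof -
      obtain g where g: "g \<in> level_group k" "f = g (L ! k)"
        using \<open>f \<in> orb (L ! k) (level_group k)\<close> by (auto simp: orb_def)
      then have g': "g \<in> \<Gamma>" "\<And>i. i < k \<Longrightarrow> g (L ! i) = L ! i"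
        using k(1) by (auto simp: level_group_iff)
      have f: "f \<in> {1..n}" using in_range[OF g'(1) L_in[OF k(1)]] g(2) by simp
      have valid: "valid_table (table us U)" using ok by (simp add: pool_ok_def)
      have "table us U k f \<noteq> None" if "f \<noteq> L ! k"
        using sifts_orbit[OF valid complete[OF g'(1)] k(1) g'(2)] g(2) that by simp
      then have "f = L ! k \<or> U k f \<noteq> 0" unfolding table_def by presburger
      then have "s1 ''x'' (int f) \<le> s1 ''x'' (int j)" using max0 max f by auto
      then show ?thesis using f j_in by (simp add: out_vector_def s1(4))
    qed
    define R where "R s3 \<longleftrightarrow> (\<forall>x. x \<notin> {''l'', ''best'', ''j'', ''d'', ''i'', ''x'', ''y''} \<longrightarrow> s3 x = s x) \<and>
      P (out_vector n s3) \<and> cuts_hold (Suc k) (out_vector n s3)" for s3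
    show "runs (Seq (If (Eq (var ''best'') (var ''l'')) Skip move_cmd)
          (set_var ''row'' (Plus (var ''row'') (var ''nn'')))) s2 (2 * loop_time n + 40) Q"
    proof (rule runs_Seq[where ?t1.0 = "2 * loop_time n + 33" and ?t2.0 = 7])
      have R: "runs (If (Eq (var ''best'') (var ''l'')) Skip move_cmd) s2 (2 * loop_time n + 33) R"
      proof (rule runs_If[where ?t1.0 = "2 * loop_time n + 8"])
        assume "bval (Eq (var ''best'') (var ''l'')) s2"
        then have "j = L ! k" using best s1(1) by (simp add: frame2)
        moreover have "id \<in> level_group k" using id_in k(1) by (simp add: level_group_iff)
        ultimately have "cuts_hold (Suc k) (perm_act id (out_vector n s))"
          using cuts_hold_step[OF k(1) x(2), of id j] max_orb by simp
        then have "cuts_hold (Suc k) (out_vector n s)" by (simp add: perm_act_def)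
        then have "R s2" unfolding R_def vec2 using x(1) by (simp add: frame2 s1(4))
        then show "runs Skip s2 (2 * loop_time n + 8) R" by (rule runs_Skip) (simp add: loop_time_def)
      next
        assume "\<not> bval (Eq (var ''best'') (var ''l'')) s2"
        then have "j \<noteq> L ! k" using best s1(1) by (simp add: frame2)
        then have U: "U k j \<noteq> 0" using j by simp
        let ?u = "us ! U k j"
        note u = table_entry[OF ok U]
        have row2: "s2 ''row'' 0 = int n * int k" using s1 by (simp add: frame2)
        show "runs move_cmd s2 (2 * loop_time n + 8) R"
        proof (rule runs_move[OF st2 ok row2 best U])
          fix s3 assume frame3: "\<And>x. x \<notin> {''d'', ''i'', ''x'', ''y''} \<Longrightarrow> s3 x = s2 x"
            and vec3: "out_vector n s3 = perm_act ?u (out_vector n s2)"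
          have "?u \<in> level_group k" using u k(1) by (simp add: level_group_iff)
          then have "cuts_hold (Suc k) (out_vector n s3)"
            unfolding vec3 vec2 using cuts_hold_step[OF k(1) x(2)] u max_orb by blast
          moreover have "P (out_vector n s3)" unfolding vec3 vec2 using sym u x(1) by simp
          ultimately show "R s3" unfolding R_def by (simp add: frame2 frame3 s1(4))
        qed
      qed simp
      show "runs (If (Eq (var ''best'') (var ''l'')) Skip move_cmd) s2 (2 * loop_time n + 33)
          (\<lambda>s3. runs (set_var ''row'' (Plus (var ''row'') (var ''nn''))) s3 7 Q)"
      proof (rule runs_mono[OF R le_refl], rule runs_Assign, rule exit)
        fix s3 assume "R s3"
        then have R: "\<And>x. x \<notin> {''l'', ''best'', ''j'', ''d'', ''i'', ''x'', ''y''} \<Longrightarrow> s3 x = s x"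
          "P (out_vector n s3)" "cuts_hold (Suc k) (out_vector n s3)" by (simp_all add: R_def)
        let ?s = "s3(''row'' := (s3 ''row'')(aval (Const 0) s3 := aval (Plus (var ''row'') (var ''nn'')) s3))"
        have vec: "out_vector n ?s = out_vector n s3" by (simp add: out_vector_def)
        show "?s x = s x" if "x \<notin> {''l'', ''best'', ''j'', ''d'', ''i'', ''x'', ''y'', ''row''}" for x
          using that by (simp add: R(1))
        show "?s ''row'' 0 = int n * int (Suc k)"
          using st k(2) by (simp add: R(1) stored_def algebra_simps)
        show "P (out_vector n ?s)" "cuts_hold (Suc k) (out_vector n ?s)"
          unfolding vec by (rule R)+
      qed simp
    qed simp
  qed
qed (simp_all add: greedy_level_time_def)

lemma runs_greedy:
  assumes st: "stored us U s" and ok: "pool_ok us U"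
    and complete: "\<And>g. g \<in> \<Gamma> \<Longrightarrow> sifts L (table us U) 0 g"
    and sym: "\<And>u y. u \<in> \<Gamma> \<Longrightarrow> P y \<Longrightarrow> P (perm_act u y)"
    and x: "P (out_vector n s)"
    and exit: "\<And>s'. s' ''status'' = s ''status'' \<Longrightarrow> P (out_vector n s') \<Longrightarrow>
      cuts_hold n (out_vector n s') \<Longrightarrow> Q s'"
  shows "runs greedy_cmd s (greedy_time n) Q"
proof -
  define V where "V = {''l'', ''best'', ''j'', ''d'', ''i'', ''x'', ''y'', ''row'', ''k''}"
  define I where "I k s' \<longleftrightarrow> (\<forall>x. x \<notin> V \<longrightarrow> s' x = s x) \<and> s' ''row'' 0 = int n * int k \<and>
    P (out_vector n s') \<and> cuts_hold k (out_vector n s')" for k s'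
  show ?thesis
    unfolding greedy_cmd_def
  proof (rule runs_Assign_Seq[where ?t1.0 = "n * (greedy_level_time n + 13) + 10"],
      rule runs_For[where I = I and n = n and tc = "greedy_level_time n"])
    let ?s = "s(''row'' := (s ''row'')(aval (Const 0) s := aval (Const 0) s))"
    show "I 0 (?s(''k'' := (?s ''k'')(0 := 1)))"
      using x by (simp add: I_def V_def out_vector_def cuts_hold_def)
  next
    fix k s' assume k: "k < n" "s' ''k'' 0 = int k + 1" and "I k s'"
    then have I: "\<And>x. x \<notin> V \<Longrightarrow> s' x = s x" "s' ''row'' 0 = int n * int k"
      "P (out_vector n s')" "cuts_hold k (out_vector n s')" by (simp_all add: I_def)
    have st': "stored us U s'" by (rule stored_cong[OF st]) (auto simp: I(1) V_def)
    show "runs greedy_level_cmd s' (greedy_level_time n) (\<lambda>s'. s' ''k'' 0 = int k + 1 \<and>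
        s' ''nn'' 0 = int n \<and> I (Suc k) (s'(''k'' := (s' ''k'')(0 := 2 + int k))))"
    proof (rule runs_greedy_level[OF st' ok complete sym I(3,4) k(1) I(2) k(2)])
      fix s2 assume frame: "\<And>x. x \<notin> {''l'', ''best'', ''j'', ''d'', ''i'', ''x'', ''y'', ''row''} \<Longrightarrow> s2 x = s' x"
        and 2: "s2 ''row'' 0 = int n * int (Suc k)" "P (out_vector n s2)" "cuts_hold (Suc k) (out_vector n s2)"
      let ?s = "s2(''k'' := (s2 ''k'')(0 := 2 + int k))"
      have vec: "out_vector n ?s = out_vector n s2" by (simp add: out_vector_def)
      have "?s x = s x" if "x \<notin> V" for x
        using that I(1)[OF that] by (simp add: frame V_def)
      moreover have "?s ''row'' 0 = int n * int (Suc k)" using 2(1) by simp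
      ultimately have "I (Suc k) ?s" unfolding I_def vec using 2(2,3) by simp
      moreover have "s2 ''k'' 0 = int k + 1" using k(2) by (simp add: frame)
      moreover have "s2 ''nn'' 0 = int n" using st' by (simp add: frame stored_def)
      ultimately show "s2 ''k'' 0 = int k + 1 \<and> s2 ''nn'' 0 = int n \<and> I (Suc k) ?s" by simp
    qed
  next
    fix s' assume "I n s'"
    then have "\<And>x. x \<notin> V \<Longrightarrow> s' x = s x"
      "P (out_vector n s')" "cuts_hold n (out_vector n s')" by (simp_all add: I_def)
    then show "Q s'" by (intro exit) (simp_all add: V_def)
  qed (use st in \<open>simp_all add: stored_def greedy_time_def\<close>)
qed

end

section \<open>The solver for the program with the cuts\<close>

definition post_cmd :: com where
  "post_cmd = Seq init_cmd (Seq closure_cmd greedy_cmd)"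

definition post_time :: "nat \<Rightarrow> nat \<Rightarrow> nat" where
  "post_time n M = init_time n M + closure_time n (M + 1 + n * n) + greedy_time n"

lemma post_time_mono: "M \<le> M' \<Longrightarrow> post_time n M \<le> post_time n M'"
  unfolding post_time_def closure_time_def init_time_def inner_time_def
  by (intro add_mono mult_le_mono) auto

lemma (in sst_run) runs_post:
  assumes "s ''nn'' 0 = int n" "s ''gens_count'' 0 = int (length G)" "s ''top'' 0 = 0"
    "\<And>k. k < n \<Longrightarrow> s ''leaders'' (int k + 1) = int (L ! k)"
    "\<And>e i. e < length G \<Longrightarrow> i \<in> {1..n} \<Longrightarrow> s ''gens'' (int n * int e + int i) = int ((G ! e) i)"
    "s ''D'' = (\<lambda>_. 0)"
    and sym: "\<And>u y. u \<in> \<Gamma> \<Longrightarrow> P y \<Longrightarrow> P (perm_act u y)"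
    and x: "P (out_vector n s)"
    and exit: "\<And>s'. s' ''status'' = s ''status'' \<Longrightarrow> P (out_vector n s') \<Longrightarrow>
      cuts_hold n (out_vector n s') \<Longrightarrow> Q s'"
  shows "runs post_cmd s (post_time n (length G)) Q"
  unfolding post_cmd_def
proof (rule runs_Seq[where ?t1.0 = "init_time n (length G)" and
    ?t2.0 = "closure_time n (length G + 1 + n * n) + greedy_time n"], rule runs_init[OF assms(1-6)])
  fix s1 assume frame1: "\<And>x. x \<notin> {''c'', ''top'', ''gens'', ''i''} \<Longrightarrow> s1 x = s x"
    and st1: "stored (G @ [id]) (\<lambda>_ _. 0) s1"
  show "runs (Seq closure_cmd greedy_cmd) s1
      (closure_time n (length G + 1 + n * n) + greedy_time n) Q"
  proof (rule runs_Seq[OF _ le_refl], rule runs_closure[OF st1 pool_ok_init le_refl])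
    fix s2 us U assume frame2: "\<And>x. x \<notin> {''a'', ''b''} \<union> scratch \<Longrightarrow> s2 x = s1 x"
      and st2: "stored us U s2" and ok: "pool_ok us U" and ext: "extends (G @ [id]) (\<lambda>_ _. 0) us U"
      and pairs: "\<And>e e'. e < length us \<Longrightarrow> e' < length us \<Longrightarrow> pair_sifts us U e e'"
    have "out_vector n s2 = out_vector n s" by (simp add: out_vector_def frame1 frame2)
    then have x2: "P (out_vector n s2)" using x by simp
    show "runs greedy_cmd s2 (greedy_time n) Q"
      by (rule runs_greedy[where P = P, OF st2 ok pair_sifts_complete[OF ok ext pairs] sym x2])
        (auto intro: exit simp: frame1 frame2)
  qed
qed (simp_all add: post_time_def)

text \<open>
  The arrays in which the given solver finds its input and leaves its output. All its other arrays get a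
  name that starts with \<open>P\<close>, which no name used for the remaining computation does.
\<close>

definition shared_arrays :: "string set" where
  "shared_arrays = {''n'', ''m'', ''A_num'', ''A_den'', ''b_num'', ''b_den'', ''c_num'', ''c_den'',
     ''x'', ''status''}"

definition private_name :: "string \<Rightarrow> string" where
  "private_name v = (if v \<in> shared_arrays then v else CHR ''P'' # v)"

lemma inj_private_name: "inj private_name"
proof (rule injI)
  fix v w assume "private_name v = private_name w"
  moreover have "CHR ''P'' # u \<notin> shared_arrays" for u by (simp add: shared_arrays_def)
  ultimately show "v = w" by (auto simp: private_name_def split: if_splits)
qed

lemma not_private:
  assumes "v \<notin> shared_arrays" "hd v \<noteq> CHR ''P''"
  shows "v \<notin> range private_name"
  using assms by (auto simp: private_name_def)

text \<open>
  The solver may overwrite \<open>n\<close>, which is therefore saved in \<open>nn\<close>. There is nothing to repair for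
  \<open>n = 0\<close>; this case is excluded because blocks of length 0 cannot be told apart by their offsets.
\<close>

definition sst_solver :: "com \<Rightarrow> com" where
  "sst_solver P = Seq (set_var ''nn'' (var ''n'')) (Seq (rename_com private_name P)
     (If (Conj (Eq (var ''status'') (Const 1)) (Less (Const 0) (var ''nn''))) post_cmd Skip))"

lemma length_concat_uniform: "(\<And>xs. xs \<in> set xss \<Longrightarrow> length xs = n) \<Longrightarrow> length (concat xss) = n * length xss"
  by (induction xss) auto

lemma nth_concat_uniform:
  assumes "\<And>xs. xs \<in> set xss \<Longrightarrow> length xs = n" "e < length xss" "i < n"
  shows "concat xss ! (n * e + i) = xss ! e ! i"
  using assms
proof (induction xss arbitrary: e)
  case (Cons xs xss)
  show ?case
  proof (cases e)
    case 0
    then show ?thesis using Cons.prems by (simp add: nth_append)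
  next
    case (Suc e')
    then show ?thesis using Cons.prems Cons.IH[of e'] by (simp add: nth_append)
  qed
qed simp

text \<open>
  The generators are laid out as required for the pool, with the first one at offset 0.
\<close>

lemma array_gens:
  assumes "e < length gens" "i \<in> {1..n}"
  shows "array [int (\<pi> i). \<pi> \<leftarrow> gens, i \<leftarrow> [1..<Suc n]] (int n * int e + int i) = int ((gens ! e) i)"
proof -
  let ?xss = "map (\<lambda>\<pi>. map (\<lambda>i. int (\<pi> i)) [1..<Suc n]) gens"
  have "length (concat ?xss) = n * length ?xss"
    by (rule length_concat_uniform) (auto simp del: upt_Suc)
  then have len: "length (concat ?xss) = n * length gens" unfolding length_map .
  have "n * Suc e \<le> n * length gens" using assms(1) by (intro mult_le_mono2) simp
  then have bound: "n * e + i \<le> n * length gens" using assms(2) by simp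
  have "int n * int e + int i - 1 = int (n * e + (i - 1))"
    using assms(2) by (simp add: of_nat_diff)
  then have nat: "nat (int n * int e + int i - 1) = n * e + (i - 1)" by (simp only: nat_int)
  have "concat ?xss ! (n * e + (i - 1)) = ?xss ! e ! (i - 1)"
    by (rule nth_concat_uniform) (use assms in auto)
  also have "\<dots> = map (\<lambda>i. int ((gens ! e) i)) [1..<Suc n] ! (i - 1)"
    unfolding nth_map[OF assms(1)] ..
  also have "\<dots> = int ((gens ! e) ([1..<Suc n] ! (i - 1)))"
    using assms(2) by (intro nth_map) (simp del: upt_Suc, linarith)
  also have "[1..<Suc n] ! (i - 1) = i" using assms(2) by (subst nth_upt) auto
  finally have nth: "concat ?xss ! (n * e + (i - 1)) = int ((gens ! e) i)" .
  have "1 \<le> int n * int e + int i" using assms(2) by (simp add: add_increasing)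
  moreover have "int n * int e + int i \<le> int (length (concat ?xss))"
    unfolding len using bound by (metis of_nat_add of_nat_mult of_nat_le_iff)
  ultimately show ?thesis unfolding array_def nat using nth by simp
qed

text \<open>
  The constant 21 accounts for saving \<open>n\<close> (4 steps) and for the test after the run of the solver (17 steps).
\<close>

lemma sst_solver_correct:
  assumes group: "is_symmetry_group n m A b c \<Gamma>"
    and gens: "\<Gamma> = generate (sym_group n) (set gens)"
    and L: "sst_output n \<Gamma> L Orb"
    and P: "solves_in_time P (ip_input n m A b c) n c (feasible n m A b) T"
  shows "solves_in_time (sst_solver P) (sst_ip_input n m A b c gens L) n c
    (feasible n m A b \<inter> cut_cone n (sst_cuts L Orb)) (T + (post_time n (length gens) + 21))"
proof -
  define X where "X = feasible n m A b"
  have sub: "subgroup \<Gamma> (sym_group n)" using group by (simp add: is_symmetry_group_def)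
  interpret sst_group n \<Gamma> L using sub L by (rule sst_output_group)
  have "X \<subseteq> real_vectors n"
    unfolding X_def feasible_def int_vectors_def real_vectors_def
    using PiE_mono[of "{1..n}" "\<lambda>_. \<int>" "\<lambda>_. UNIV :: real set"] by blast
  then have X_cuts: "X \<inter> cut_cone n (sst_cuts L Orb) = {x \<in> X. cuts_hold n x}"
    using cut_cone_iff_cuts_hold[OF sub L] by blast
  have sym: "perm_act u y \<in> X \<and> objective n c (perm_act u y) = objective n c y"
    if "u \<in> \<Gamma>" "y \<in> X" for u y
    using group that by (auto simp: is_symmetry_group_def is_symmetry_def X_def)
  obtain t s' where exec: "exec P (ip_input n m A b c) t s'" "t \<le> T"
    and out: "correct_output n c X s'"
    using P by (auto simp: solves_in_time_def X_def)
  define s0 where "s0 = sst_ip_input n m A b c gens L"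
  define s1 where "s1 = s0(''nn'' := (s0 ''nn'')(0 := s0 ''n'' 0))"
  have "s1 (private_name v) = ip_input n m A b c v" for v
  proof (cases "v \<in> shared_arrays")
    case True
    then show ?thesis
      by (auto simp: private_name_def shared_arrays_def s1_def s0_def sst_ip_input_def)
  next
    case False
    then have "ip_input n m A b c v = (\<lambda>_. 0)" by (auto simp: shared_arrays_def ip_input_def)
    then show ?thesis
      using False by (simp add: private_name_def s1_def s0_def sst_ip_input_def ip_input_def)
  qed
  then obtain s2 where s2: "exec (rename_com private_name P) s1 t s2"
    "(\<lambda>v. s2 (private_name v)) = s'" "\<And>v. v \<notin> range private_name \<Longrightarrow> s2 v = s1 v"
    using exec_rename[OF exec(1) inj_private_name] by blast
  have keep: "s2 v = s1 v" if "v \<notin> shared_arrays" "hd v \<noteq> CHR ''P''" for v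
    using s2(3) not_private that by blast
  have shared: "s2 v = s' v" if "v \<in> shared_arrays" for v
    using s2(2) that by (metis private_name_def)
  have out2: "out_vector n s2 = out_vector n s'" "s2 ''status'' = s' ''status''"
    using shared by (simp_all add: out_vector_def shared_arrays_def)
  have nn: "s2 ''nn'' 0 = int n"
    using keep[of "''nn''"]
    by (simp add: shared_arrays_def s1_def s0_def sst_ip_input_def ip_input_def scalar_def)
  define good where "good s \<longleftrightarrow> correct_output n c (X \<inter> cut_cone n (sst_cuts L Orb)) s" for s
  have final: "runs (If (Conj (Eq (var ''status'') (Const 1)) (Less (Const 0) (var ''nn''))) post_cmd Skip)
      s2 (post_time n (length gens) + 17) good"
  proof (rule runs_If[where ?t1.0 = "post_time n (length gens)"])
    assume "bval (Conj (Eq (var ''status'') (Const 1)) (Less (Const 0) (var ''nn''))) s2"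
    then have status: "s2 ''status'' 0 = 1" and n: "0 < n" using nn by auto
    then have opt: "out_vector n s2 \<in> X" "\<And>y. y \<in> X \<Longrightarrow> objective n c y \<le> objective n c (out_vector n s2)"
      using out out2 by (auto simp: correct_output_def)
    interpret sst_run n \<Gamma> L gens
    proof unfold_locales
      show "set gens \<subseteq> \<Gamma>" unfolding gens by (blast intro: generate.incl)
    qed (fact gens n)+
    let ?P = "\<lambda>x. x \<in> X \<and> objective n c x = objective n c (out_vector n s2)"
    show "runs post_cmd s2 (post_time n (length gens)) good"
    proof (rule runs_post[where P = ?P and s = s2])
      show "s2 ''gens_count'' 0 = int (length gens)"
        using keep[of "''gens_count''"]
        by (simp add: shared_arrays_def s1_def s0_def sst_ip_input_def scalar_def)
      show "s2 ''nn'' 0 = int n" by (rule nn)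
      show "s2 ''top'' 0 = 0" "s2 ''D'' = (\<lambda>_. 0)"
        using keep[of "''top''"] keep[of "''D''"]
        by (simp_all add: shared_arrays_def s1_def s0_def sst_ip_input_def ip_input_def)
      show "s2 ''leaders'' (int k + 1) = int (L ! k)" if "k < n" for k
        using keep[of "''leaders''"] that length_L
        by (simp add: shared_arrays_def s1_def s0_def sst_ip_input_def array_def)
      show "s2 ''gens'' (int n * int e + int i) = int ((gens ! e) i)"
        if "e < length gens" "i \<in> {1..n}" for e i
        using keep[of "''gens''"] array_gens[OF that]
        by (simp add: shared_arrays_def s1_def s0_def sst_ip_input_def)
      show "?P (perm_act u y)" if "u \<in> \<Gamma>" "?P y" for u y using sym that by simp
      show "?P (out_vector n s2)" using opt by simp
      fix s3 assume "s3 ''status'' = s2 ''status''" "?P (out_vector n s3)"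
        "cuts_hold n (out_vector n s3)"
      then show "good s3"
        unfolding good_def correct_output_def X_cuts using status opt(2) by simp
    qed
  next
    assume "\<not> bval (Conj (Eq (var ''status'') (Const 1)) (Less (Const 0) (var ''nn''))) s2"
    then have case_split: "s2 ''status'' 0 \<noteq> 1 \<or> n = 0" using nn by auto
    consider "s' ''status'' 0 = 0" "X = {}"
      | "s' ''status'' 0 = 1" "out_vector n s' \<in> X"
        "\<forall>y\<in>X. objective n c y \<le> objective n c (out_vector n s')"
      | "s' ''status'' 0 = 2" "\<forall>B. \<exists>y\<in>X. objective n c y > B"
      using out by (auto simp: correct_output_def)
    then have "good s2"
    proof cases
      case 1
      then show ?thesis using out2 by (simp add: good_def correct_output_def)
    next
      case 2
      then have "cuts_hold n (out_vector n s2)" using case_split out2 by (simp add: cuts_hold_def)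
      then show ?thesis
        unfolding good_def correct_output_def X_cuts using 2 out2 by simp
    next
      case 3
      have "\<exists>y\<in>{x \<in> X. cuts_hold n x}. objective n c y > B" for B
      proof -
        obtain y where "y \<in> X" "objective n c y > B" using 3 by blast
        then have "\<exists>y. (y \<in> X \<and> objective n c y > B) \<and> cuts_hold n y"
          using sym by (intro exists_cuts_hold) auto
        then show ?thesis by blast
      qed
      then show ?thesis
        unfolding good_def correct_output_def X_cuts using 3 out2 by simp
    qed
    then show "runs Skip s2 (post_time n (length gens)) good"
      by (rule runs_Skip) (simp add: post_time_def closure_time_def)
  qed simp
  have renamed: "runs (rename_com private_name P) s1 T (\<lambda>s. s = s2)"
    unfolding runs_def using s2(1) exec(2) by blast
  have "runs (sst_solver P) s0 (T + (post_time n (length gens) + 21)) good"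
    unfolding sst_solver_def
  proof (rule runs_Assign_Seq[where ?t1.0 = "T + (post_time n (length gens) + 17)"],
      rule runs_Seq[where ?t1.0 = T and ?t2.0 = "post_time n (length gens) + 17"])
    let ?s = "s0(''nn'' := (s0 ''nn'')(aval (Const 0) s0 := aval (var ''n'') s0))"
    have "?s = s1" by (simp add: s1_def)
    then show "runs (rename_com private_name P) ?s T (\<lambda>s. runs
        (If (Conj (Eq (var ''status'') (Const 1)) (Less (Const 0) (var ''nn''))) post_cmd Skip) s
        (post_time n (length gens) + 17) good)"
      using renamed final by (auto intro: runs_mono)
  qed simp_all
  then show ?thesis
    unfolding runs_def solves_in_time_def good_def s0_def X_def by blast
qed

lemma poly_bound_exists:
  fixes q :: "nat poly"
  shows "\<exists>p :: nat poly. \<forall>n. poly p n = post_time n (poly q n) + 21"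
proof -
  define is_poly :: "(nat \<Rightarrow> nat) \<Rightarrow> bool" where "is_poly f \<longleftrightarrow> (\<exists>p. \<forall>n. poly p n = f n)" for f
  have const: "is_poly (\<lambda>_. k)" for k
    unfolding is_poly_def by (intro exI[of _ "[:k:]"]) simp
  have var: "is_poly (\<lambda>n. n)"
    unfolding is_poly_def by (intro exI[of _ "[:0, 1:]"]) simp
  have q: "is_poly (poly q)" unfolding is_poly_def by blast
  have add: "is_poly (\<lambda>n. f n + g n)" if "is_poly f" "is_poly g" for f g
    using that unfolding is_poly_def by (metis poly_add)
  have mult: "is_poly (\<lambda>n. f n * g n)" if "is_poly f" "is_poly g" for f g
    using that unfolding is_poly_def by (metis poly_mult)
  have "is_poly (\<lambda>n. post_time n (poly q n) + 21)"
    unfolding post_time_def init_time_def closure_time_def inner_time_def greedy_time_def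
      greedy_level_time_def best_time_def pair_time_def sift_time_def level_time_def loop_time_def
    by (intro add mult const var q)
  then show ?thesis unfolding is_poly_def .
qed

theorem theorem3p1:
  fixes q :: "nat poly"
  shows "\<exists>p :: nat poly. \<forall>P. \<exists>Q. \<forall>n m A b c \<Gamma> gens L Orb S T.
           is_symmetry_group n m A b c \<Gamma> \<longrightarrow>
           set gens \<subseteq> carrier (sym_group n) \<longrightarrow>
           \<Gamma> = generate (sym_group n) (set gens) \<longrightarrow>
           length gens \<le> poly q n \<longrightarrow>
           sst_output n \<Gamma> L Orb \<longrightarrow>
           S = sst_cuts L Orb \<longrightarrow>
           solves_in_time P (ip_input n m A b c) n c (feasible n m A b) T \<longrightarrow>
           solves_in_time Q (sst_ip_input n m A b c gens L) n c
             (feasible n m A b \<inter> cut_cone n S) (T + poly p n)"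
proof -
  obtain p :: "nat poly" where p: "\<And>n. poly p n = post_time n (poly q n) + 21"
    using poly_bound_exists by blast
  have "solves_in_time (sst_solver P) (sst_ip_input n m A b c gens L) n c
      (feasible n m A b \<inter> cut_cone n S) (T + poly p n)"
    if "is_symmetry_group n m A b c \<Gamma>" "set gens \<subseteq> carrier (sym_group n)"
      "\<Gamma> = generate (sym_group n) (set gens)" "length gens \<le> poly q n" "sst_output n \<Gamma> L Orb"
      "S = sst_cuts L Orb" "solves_in_time P (ip_input n m A b c) n c (feasible n m A b) T"
    for P n m A b c \<Gamma> gens L Orb S T
  proof -
    have "T + (post_time n (length gens) + 21) \<le> T + poly p n"
      using post_time_mono[OF that(4), of n] by (simp add: p)
    then show ?thesis
      using sst_solver_correct[OF that(1,3,5,7)] that(6) le_trans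
      unfolding solves_in_time_def by blast
  qed
  then show ?thesis by blast
qed

end
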